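(* Let $D_x,D_y:V\to V$ be the two-block difference operators $D_x=H^{-1}E_x^TH^{(+)}D_x^{(+)}E_x$ and $D_y=H^{-1}E_x^TH^{(+)}D_y^{(+)}E_x$ for two blocks joined in the $x$-direction, and let $H_2\in\mathbb{R}^{(N_2+1)\times(N_2+1)}$ be symmetric positive definite. Then (i) $D_x,D_y$ satisfy summation by parts with respect to the inner product $(u,v)=u^THv$, i.e. for all $u,v\in V$ $$(u,D_xv)=\langle u,v\rangle_2-\langle u,v\rangle_4-(D_xu,v),\qquad (u,D_yv)=\langle u,v\rangle_3-\langle u,v\rangle_1-(D_yu,v),$$ if and only if $H_2^{(1)}=H_2^{(2)}=H_2$. (ii) $D_x,D_y$ are consistent approximations of $\partial/\partial x$ and $\partial/\partial y$. (iii) $D_x=E_x^+D_x^{(+)}E_x$ and $D_y=E_x^+D_y^{(+)}E_x$.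
   Context: $\Omega_1=[0,1/2]\times[0,1]$, $\Omega_2=[1/2,1]\times[0,1]$ have uniform grids with $(N_1^{(k)}+1)(N_2+1)$ points, $k=1,2$, with mesh sizes $h_1^{(k)}=1/(2N_1^{(k)})$ in $x$ and $h_2=1/N_2$ in $y$ (grid lines match at $x=1/2$). Put $N_1=N_1^{(1)}+N_1^{(2)}$. Grid vectors are row-ordered ($x$-index inner, $y$-index outer). On block $k$: $H^{(k)}=H_2^{(k)}\otimes H_1^{(k)}$, $D_x^{(k)}=I_2\otimes D_1^{(k)}$, $D_y^{(k)}=D_2^{(k)}\otimes I_1^{(k)}$, where $H_1^{(k)}\in\mathbb{R}^{(N_1^{(k)}+1)\times(N_1^{(k)}+1)}$, $H_2^{(k)}\in\mathbb{R}^{(N_2+1)\times(N_2+1)}$ are symmetric positive definite, $I_1^{(k)},I_2$ are identities, and $D_l^{(k)}$ is a one-dimensional consistent difference operator satisfying summation by parts with respect to $H_l^{(k)}$: $a^THDb=a_Mb_M-a_0b_0-(Da)^THb$ for all vectors $a=(a_0,\dots,a_M)^T$, $b$ (with $H=H_l^{(k)}$, $D=D_l^{(k)}$). $H^{(+)}=\mathrm{diag}(H^{(1)},H^{(2)})$, $D_x^{(+)}=\mathrm{diag}(D_x^{(1)},D_x^{(2)})$, $D_y^{(+)}=\mathrm{diag}(D_y^{(1)},D_y^{(2)})$; $V_+$ is the space of pairs $(u^{(1)};u^{(2)})$ with inner product given by $H^{(+)}$. $E_1^{(1)}\in\mathbb{R}^{(N_1^{(1)}+1)\times(N_1+1)}$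 and $E_1^{(2)}\in\mathbb{R}^{(N_1^{(2)}+1)\times(N_1+1)}$ extract the components with indices $0,\dots,N_1^{(1)}$ and $N_1^{(1)},\dots,N_1$ respectively; $E_x^{(k)}=I_2\otimes E_1^{(k)}$ and $E_x=(E_x^{(1)};E_x^{(2)})$ (stacked). $V=\mathbb{R}^{(N_1+1)(N_2+1)}$ has inner product $(u,v)=u^THv$ with $H=E_x^TH^{(+)}E_x$. $E_x^+$ is the Moore–Penrose pseudoinverse of $E_x:V\to V_+$ with respect to these inner products ($E_xE_x^+E_x=E_x$, $E_x^+E_xE_x^+=E_x^+$, $E_x^+E_x$ and $E_xE_x^+$ self-adjoint). For $u=(u_{ij})\in V$, $0\le i\le N_1$, $0\le j\le N_2$, let $u_j=(u_{0j},\dots,u_{N_1j})^T$ and $u^i=(u_{i0},\dots,u_{iN_2})^T$. Let $H_1=[E_1^{(1)}]^TH_1^{(1)}E_1^{(1)}+[E_1^{(2)}]^TH_1^{(2)}E_1^{(2)}$. Boundary products: $\langle u,v\rangle_1=u_0^TH_1v_0$, $\langle u,v\rangle_2=[u^{N_1}]^TH_2v^{N_1}$, $\langle u,v\rangle_3=u_{N_2}^TH_1v_{N_2}$, $\langle u,v\rangle_4=[u^0]^TH_2v^0$. Consistency: the block operators are assumed consistent of some order $p>0$, meaning that for each smooth $u$, with superscript $(k)$ denoting restriction to the grid of block $k$, $D_x^{(k)}u^{(k)}=u_x^{(k)}+\mathcal{O}(h^p)$ and $D_y^{(k)}u^{(k)}=u_y^{(k)}+\mathcal{O}(h^p)$ as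 the maximal mesh size $h\to0$; consistency of $D_x,D_y$ means $D_xu=u_x+\mathcal{O}(h^p)$, $D_yu=u_y+\mathcal{O}(h^p)$ for grid restrictions to $\Omega_1\cup\Omega_2$. The $\mathcal{O}(h^p)$ terms are measured in the norms induced by the inner products of the respective spaces. *)

theory Defs
  imports
    "HOL-Analysis.Derivative"
    "HOL-Library.Landau_Symbols"
    "Jordan_Normal_Form.Gauss_Jordan_Elimination"
begin

definition spd :: "nat \<Rightarrow> real mat \<Rightarrow> bool" where
  "spd n A \<longleftrightarrow> A \<in> carrier_mat n n \<and> transpose_mat A = A \<and>
     (\<forall>v \<in> carrier_vec n. v \<noteq> 0\<^sub>v n \<longrightarrow> scalar_prod v (A *\<^sub>v v) > 0)"

definition kron :: "real mat \<Rightarrow> real mat \<Rightarrow> real mat" where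
  "kron A B = mat (dim_row A * dim_row B) (dim_col A * dim_col B)
     (\<lambda>(r, c). A $$ (r div dim_row B, c div dim_col B) * B $$ (r mod dim_row B, c mod dim_col B))"

definition ip :: "real mat \<Rightarrow> real vec \<Rightarrow> real vec \<Rightarrow> real" where
  "ip W u v = scalar_prod u (W *\<^sub>v v)"

definition ip_norm :: "real mat \<Rightarrow> real vec \<Rightarrow> real" where
  "ip_norm W u = sqrt (ip W u u)"

text \<open>The Moore--Penrose pseudoinverse of \<open>A\<close>, regarded as a map from the space with inner
  product \<open>ip W\<close> to the space with inner product \<open>ip W'\<close>. For symmetric positive definite
  \<open>W\<close> and \<open>W'\<close> of matching dimensions it exists and is unique.\<close>

definition is_mp_inverse :: "real mat \<Rightarrow> real mat \<Rightarrow> real mat \<Rightarrow> real mat \<Rightarrow> bool" where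
  "is_mp_inverse W W' A X \<longleftrightarrow>
     X \<in> carrier_mat (dim_col A) (dim_row A) \<and>
     A * X * A = A \<and> X * A * X = X \<and>
     (\<forall>u \<in> carrier_vec (dim_col A). \<forall>v \<in> carrier_vec (dim_col A).
        ip W ((X * A) *\<^sub>v u) v = ip W u ((X * A) *\<^sub>v v)) \<and>
     (\<forall>u \<in> carrier_vec (dim_row A). \<forall>v \<in> carrier_vec (dim_row A).
        ip W' ((A * X) *\<^sub>v u) v = ip W' u ((A * X) *\<^sub>v v))"

definition mp_inverse :: "real mat \<Rightarrow> real mat \<Rightarrow> real mat \<Rightarrow> real mat" where
  "mp_inverse W W' A = (THE X. is_mp_inverse W W' A X)"

definition sbp_1d :: "nat \<Rightarrow> real mat \<Rightarrow> real mat \<Rightarrow> bool" where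
  "sbp_1d M H D \<longleftrightarrow> D \<in> carrier_mat (M + 1) (M + 1) \<and>
     (\<forall>a \<in> carrier_vec (M + 1). \<forall>b \<in> carrier_vec (M + 1).
        ip H a (D *\<^sub>v b) = a $ M * b $ M - a $ 0 * b $ 0 - ip H (D *\<^sub>v a) b)"

text \<open>The block index \<open>k\<close> ranges over \<open>{1, 2}\<close>: \<open>Nx g k\<close>, \<open>Hx g k\<close>, \<open>Dx1 g k\<close> are the number of
  cells, the norm matrix and the difference operator of block \<open>k\<close> in direction \<open>x\<close>, and
  \<open>Hy g k\<close>, \<open>Dy1 g k\<close> are the matrices of block \<open>k\<close> in direction \<open>y\<close>. The number \<open>Ny g\<close> of cells
  in direction \<open>y\<close> is common to both blocks.\<close>

record two_block =
  Nx :: "nat \<Rightarrow> nat"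
  Ny :: nat
  Hx :: "nat \<Rightarrow> real mat"
  Hy :: "nat \<Rightarrow> real mat"
  Dx1 :: "nat \<Rightarrow> real mat"
  Dy1 :: "nat \<Rightarrow> real mat"

definition sbp_blocks :: "two_block \<Rightarrow> bool" where
  "sbp_blocks g \<longleftrightarrow> Ny g \<ge> 1 \<and>
     (\<forall>k \<in> {1, 2}. Nx g k \<ge> 1 \<and>
        spd (Nx g k + 1) (Hx g k) \<and> sbp_1d (Nx g k) (Hx g k) (Dx1 g k) \<and>
        spd (Ny g + 1) (Hy g k) \<and> sbp_1d (Ny g) (Hy g k) (Dy1 g k))"

definition Nxt :: "two_block \<Rightarrow> nat" where
  "Nxt g = Nx g 1 + Nx g 2"

definition hx :: "two_block \<Rightarrow> nat \<Rightarrow> real" where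
  "hx g k = 1 / (2 * real (Nx g k))"

definition hy :: "two_block \<Rightarrow> real" where
  "hy g = 1 / real (Ny g)"

definition hmax :: "two_block \<Rightarrow> real" where
  "hmax g = Max {hx g 1, hx g 2, hy g}"

definition Hblk :: "two_block \<Rightarrow> nat \<Rightarrow> real mat" where
  "Hblk g k = kron (Hy g k) (Hx g k)"

definition Dxblk :: "two_block \<Rightarrow> nat \<Rightarrow> real mat" where
  "Dxblk g k = kron (1\<^sub>m (Ny g + 1)) (Dx1 g k)"

definition Dyblk :: "two_block \<Rightarrow> nat \<Rightarrow> real mat" where
  "Dyblk g k = kron (Dy1 g k) (1\<^sub>m (Nx g k + 1))"

definition Hplus :: "two_block \<Rightarrow> real mat" where
  "Hplus g = diag_block_mat [Hblk g 1, Hblk g 2]"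

definition Dxplus :: "two_block \<Rightarrow> real mat" where
  "Dxplus g = diag_block_mat [Dxblk g 1, Dxblk g 2]"

definition Dyplus :: "two_block \<Rightarrow> real mat" where
  "Dyplus g = diag_block_mat [Dyblk g 1, Dyblk g 2]"

text \<open>Global \<open>x\<close>-index of the first grid column of block \<open>k\<close>; the interface column \<open>Nx g 1\<close>
  belongs to both blocks.\<close>

definition offset :: "two_block \<Rightarrow> nat \<Rightarrow> nat" where
  "offset g k = (if k = 1 then 0 else Nx g 1)"

definition E1 :: "two_block \<Rightarrow> nat \<Rightarrow> real mat" where
  "E1 g k = mat (Nx g k + 1) (Nxt g + 1) (\<lambda>(r, c). if c = offset g k + r then 1 else 0)"

definition Eblk :: "two_block \<Rightarrow> nat \<Rightarrow> real mat" where
  "Eblk g k = kron (1\<^sub>m (Ny g + 1)) (E1 g k)"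

definition Emat :: "two_block \<Rightarrow> real mat" where
  "Emat g = append_rows (Eblk g 1) (Eblk g 2)"

definition dimV :: "two_block \<Rightarrow> nat" where
  "dimV g = (Nxt g + 1) * (Ny g + 1)"

definition Hmat :: "two_block \<Rightarrow> real mat" where
  "Hmat g = transpose_mat (Emat g) * Hplus g * Emat g"

definition Dx :: "two_block \<Rightarrow> real mat" where
  "Dx g = the (mat_inverse (Hmat g)) * transpose_mat (Emat g) * Hplus g * Dxplus g * Emat g"

definition Dy :: "two_block \<Rightarrow> real mat" where
  "Dy g = the (mat_inverse (Hmat g)) * transpose_mat (Emat g) * Hplus g * Dyplus g * Emat g"

definition Expinv :: "two_block \<Rightarrow> real mat" where
  "Expinv g = mp_inverse (Hmat g) (Hplus g) (Emat g)"

definition H1mat :: "two_block \<Rightarrow> real mat" where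
  "H1mat g = transpose_mat (E1 g 1) * Hx g 1 * E1 g 1 + transpose_mat (E1 g 2) * Hx g 2 * E1 g 2"

text \<open>The component \<open>u\<^sub>i\<^sub>j\<close> of a row-ordered grid vector is stored at position
  \<open>j * (Nxt g + 1) + i\<close>.\<close>

definition row_at :: "two_block \<Rightarrow> nat \<Rightarrow> real vec \<Rightarrow> real vec" where
  "row_at g j u = vec (Nxt g + 1) (\<lambda>i. u $ (j * (Nxt g + 1) + i))"

definition col_at :: "two_block \<Rightarrow> nat \<Rightarrow> real vec \<Rightarrow> real vec" where
  "col_at g i u = vec (Ny g + 1) (\<lambda>j. u $ (j * (Nxt g + 1) + i))"

definition bp1 :: "two_block \<Rightarrow> real vec \<Rightarrow> real vec \<Rightarrow> real" where
  "bp1 g u v = ip (H1mat g) (row_at g 0 u) (row_at g 0 v)"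

definition bp2 :: "two_block \<Rightarrow> real mat \<Rightarrow> real vec \<Rightarrow> real vec \<Rightarrow> real" where
  "bp2 g H2 u v = ip H2 (col_at g (Nxt g) u) (col_at g (Nxt g) v)"

definition bp3 :: "two_block \<Rightarrow> real vec \<Rightarrow> real vec \<Rightarrow> real" where
  "bp3 g u v = ip (H1mat g) (row_at g (Ny g) u) (row_at g (Ny g) v)"

definition bp4 :: "two_block \<Rightarrow> real mat \<Rightarrow> real vec \<Rightarrow> real vec \<Rightarrow> real" where
  "bp4 g H2 u v = ip H2 (col_at g 0 u) (col_at g 0 v)"

definition sbp_2d :: "two_block \<Rightarrow> real mat \<Rightarrow> bool" where
  "sbp_2d g H2 \<longleftrightarrow>
     (\<forall>u \<in> carrier_vec (dimV g). \<forall>v \<in> carrier_vec (dimV g).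
        ip (Hmat g) u (Dx g *\<^sub>v v) = bp2 g H2 u v - bp4 g H2 u v - ip (Hmat g) (Dx g *\<^sub>v u) v \<and>
        ip (Hmat g) u (Dy g *\<^sub>v v) = bp3 g u v - bp1 g u v - ip (Hmat g) (Dy g *\<^sub>v u) v)"

fun Ck_on :: "nat \<Rightarrow> (real \<times> real) set \<Rightarrow> (real \<times> real \<Rightarrow> real) \<Rightarrow> bool" where
  "Ck_on 0 U u \<longleftrightarrow> continuous_on U u"
| "Ck_on (Suc n) U u \<longleftrightarrow> u differentiable_on U \<and>
     (\<forall>v. Ck_on n U (\<lambda>z. frechet_derivative u (at z) v))"

definition Omega :: "nat \<Rightarrow> (real \<times> real) set" where
  "Omega k = (if k = 1 then {0..1/2} \<times> {0..1} else {1/2..1} \<times> {0..1})"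

text \<open>A function is smooth on a closed set if it is \<open>C\<^sup>\<infinity>\<close> on some open neighbourhood of the set.
  In particular its partial derivatives at boundary points are ordinary two-sided derivatives.\<close>

definition smooth_near :: "(real \<times> real) set \<Rightarrow> (real \<times> real \<Rightarrow> real) \<Rightarrow> bool" where
  "smooth_near S u \<longleftrightarrow> (\<exists>U. open U \<and> S \<subseteq> U \<and> (\<forall>n. Ck_on n U u))"

definition ddx :: "(real \<times> real \<Rightarrow> real) \<Rightarrow> real \<times> real \<Rightarrow> real" where
  "ddx u = (\<lambda>(x, y). deriv (\<lambda>s. u (s, y)) x)"

definition ddy :: "(real \<times> real \<Rightarrow> real) \<Rightarrow> real \<times> real \<Rightarrow> real" where
  "ddy u = (\<lambda>(x, y). deriv (\<lambda>s. u (x, s)) y)"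

definition xblk :: "two_block \<Rightarrow> nat \<Rightarrow> nat \<Rightarrow> real" where
  "xblk g k i = (if k = 1 then 0 else 1/2) + real i * hx g k"

definition xglob :: "two_block \<Rightarrow> nat \<Rightarrow> real" where
  "xglob g i = (if i \<le> Nx g 1 then xblk g 1 i else xblk g 2 (i - Nx g 1))"

definition yglob :: "two_block \<Rightarrow> nat \<Rightarrow> real" where
  "yglob g j = real j * hy g"

definition restr_blk :: "two_block \<Rightarrow> nat \<Rightarrow> (real \<times> real \<Rightarrow> real) \<Rightarrow> real vec" where
  "restr_blk g k u = vec ((Nx g k + 1) * (Ny g + 1))
     (\<lambda>r. u (xblk g k (r mod (Nx g k + 1)), yglob g (r div (Nx g k + 1))))"

definition restr :: "two_block \<Rightarrow> (real \<times> real \<Rightarrow> real) \<Rightarrow> real vec" where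
  "restr g u = vec (dimV g) (\<lambda>r. u (xglob g (r mod (Nxt g + 1)), yglob g (r div (Nxt g + 1))))"

text \<open>Consistency concerns a family of discretizations, indexed by an arbitrary type. The filter
  below expresses \<open>h \<rightarrow> 0\<close>, where \<open>h\<close> is the maximal mesh size: a property holds eventually iff, for
  some \<open>\<delta> > 0\<close>, it holds for all members of the family with \<open>0 < h < \<delta>\<close>.\<close>

definition refine :: "('i \<Rightarrow> two_block) \<Rightarrow> 'i filter" where
  "refine g = filtercomap (\<lambda>t. hmax (g t)) (at_right 0)"

definition blocks_consistent :: "('i \<Rightarrow> two_block) \<Rightarrow> real \<Rightarrow> bool" where
  "blocks_consistent g p \<longleftrightarrow>
     (\<forall>k \<in> {1, 2}. \<forall>u. smooth_near (Omega 1 \<union> Omega 2) u \<longrightarrow>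
        (\<lambda>t. ip_norm (Hblk (g t) k)
               (Dxblk (g t) k *\<^sub>v restr_blk (g t) k u - restr_blk (g t) k (ddx u)))
          \<in> O[refine g](\<lambda>t. hmax (g t) powr p) \<and>
        (\<lambda>t. ip_norm (Hblk (g t) k)
               (Dyblk (g t) k *\<^sub>v restr_blk (g t) k u - restr_blk (g t) k (ddy u)))
          \<in> O[refine g](\<lambda>t. hmax (g t) powr p))"

definition consistent_x :: "('i \<Rightarrow> two_block) \<Rightarrow> real \<Rightarrow> bool" where
  "consistent_x g p \<longleftrightarrow>
     (\<forall>u. smooth_near (Omega 1 \<union> Omega 2) u \<longrightarrow>
        (\<lambda>t. ip_norm (Hmat (g t)) (Dx (g t) *\<^sub>v restr (g t) u - restr (g t) (ddx u)))
          \<in> O[refine g](\<lambda>t. hmax (g t) powr p))"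

definition consistent_y :: "('i \<Rightarrow> two_block) \<Rightarrow> real \<Rightarrow> bool" where
  "consistent_y g p \<longleftrightarrow>
     (\<forall>u. smooth_near (Omega 1 \<union> Omega 2) u \<longrightarrow>
        (\<lambda>t. ip_norm (Hmat (g t)) (Dy (g t) *\<^sub>v restr (g t) u - restr (g t) (ddy u)))
          \<in> O[refine g](\<lambda>t. hmax (g t) powr p))"

end

theory Submission
  imports Defs "Jordan_Normal_Form.Determinant"
begin

text \<open>
  The whole proposition rests on one matrix, \<open>X = H\<^sup>-\<^sup>1 E\<^sup>T H\<^sub>+\<close>, where \<open>E\<close> copies a global grid
  function to the two blocks (doubling the interface column), \<open>H\<^sub>+\<close> is the block-diagonal weight
  and \<open>H = E\<^sup>T H\<^sub>+ E\<close>. By definition the glued operators are \<open>X D\<^sub>+ E\<close>.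

  The matrix \<open>X\<close> is characterised by the normal equation \<open>H X = E\<^sup>T H\<^sub>+\<close>. It satisfies \<open>X E = 1\<close>,
  and \<open>E X\<close> is the \<open>H\<^sub>+\<close>-orthogonal projection onto the range of \<open>E\<close>. Every Moore--Penrose inverse
  of \<open>E\<close> solves the normal equation as well, so \<open>X\<close> is the pseudoinverse; this is part (iii)
  (\<open>mp_inverse_eq_weighted_left_inverse\<close>).

  For part (ii), \<open>X E = 1\<close> turns the global truncation error into \<open>X\<close> applied to the pair of block
  truncation errors, because \<open>E\<close> maps the global restriction of a function to the pair of its block
  restrictions. Being an orthogonal projection followed by the inverse of the isometry \<open>E\<close>, \<open>X\<close> does not increase norms,
  so the global error is at most the sum of the block errors (\<open>glued_truncation_error\<close>).

  For part (i), summation by parts with boundary form \<open>C\<close> says that \<open>H D + (H D)\<^sup>T = C\<close>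
  (\<open>sbp_iff_mat\<close>). The normal equation cancels \<open>H\<^sup>-\<^sup>1\<close>: \<open>H (X D\<^sub>+ E) = E\<^sup>T H\<^sub>+ D\<^sub>+ E\<close> is a sum of two
  Kronecker products. In the \<open>x\<close>-direction its symmetric part is
  \<open>H\<^sub>2\<^sup>(\<^sup>1\<^sup>) \<otimes> (e\<^sub>m - e\<^sub>0) + H\<^sub>2\<^sup>(\<^sup>2\<^sup>) \<otimes> (e\<^sub>N - e\<^sub>m)\<close>, with \<open>e\<^sub>i\<close> the diagonal matrix unit at column \<open>i\<close>
  and \<open>m\<close> the interface column. This equals \<open>H\<^sub>2 \<otimes> (e\<^sub>N - e\<^sub>0)\<close> exactly if both blocks use \<open>H\<^sub>2\<close>:
  the outer boundary columns force the equalities, and then the interface terms cancel. In the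
  \<open>y\<close>-direction the boundary term \<open>(e\<^sub>N - e\<^sub>0) \<otimes> H\<^sub>1\<close> comes out whatever the weights
  \<open>H\<^sub>2\<^sup>(\<^sup>k\<^sup>)\<close> are.

  All of this needs \<open>H\<close> to be invertible, hence the Kronecker product of positive definite
  matrices to be positive definite (\<open>spd_kron\<close>). That is obtained from factorisations
  \<open>A = L\<^sup>T L\<close> and \<open>B = M\<^sup>T M\<close>, since then \<open>A \<otimes> B = (L \<otimes> M)\<^sup>T (L \<otimes> M)\<close>.
\<close>

section \<open>Kronecker products\<close>

lemma sum_lessThan_mult:
  fixes f :: "nat \<Rightarrow> 'a::comm_monoid_add"
  shows "(\<Sum>k<n * m. f k) = (\<Sum>j<n. \<Sum>i<m. f (j * m + i))"
proof -
  have "(\<Sum>i<m. f (j * m + i)) = sum f {j * m..<j * m + m}" for j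
    by (rule sum.reindex_bij_witness[of _ "\<lambda>k. k - j * m" "\<lambda>i. j * m + i"]) auto
  then show ?thesis by (simp add: sum.nat_group)
qed

lemma block_index_less:
  fixes i j :: nat
  assumes "j < n" "i < m"
  shows "j * m + i < n * m"
proof -
  have "j * m + i < Suc j * m" using assms by simp
  also have "\<dots> \<le> n * m" using assms by (intro mult_le_mono1) simp
  finally show ?thesis .
qed

lemma block_index_div_mod:
  fixes i j :: nat
  assumes "i < m"
  shows "(j * m + i) mod m = i" "(j * m + i) div m = j"
  using assms by auto

lemma kron_carrier [simp]:
  "A \<in> carrier_mat a b \<Longrightarrow> B \<in> carrier_mat c d \<Longrightarrow> kron A B \<in> carrier_mat (a * c) (b * d)"
  by (auto simp: kron_def)

lemma index_kron:
  assumes "A \<in> carrier_mat a b" "B \<in> carrier_mat c d" "r < a * c" "s < b * d"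
  shows "kron A B $$ (r, s) = A $$ (r div c, s div d) * B $$ (r mod c, s mod d)"
  using assms by (auto simp: kron_def)

lemma index_kron_block:
  assumes "A \<in> carrier_mat a b" "B \<in> carrier_mat c d" "j < a" "i < c" "j' < b" "i' < d"
  shows "kron A B $$ (j * c + i, j' * d + i') = A $$ (j, j') * B $$ (i, i')"
  using assms by (subst index_kron) (auto simp: block_index_less)

lemma div_mod_less:
  assumes "r < n * (m::nat)"
  shows "r div m < n" "r mod m < m"
proof -
  have "m > 0" using assms by (cases m) auto
  then show "r div m < n" "r mod m < m" using assms by (auto simp: less_mult_imp_div_less)
qed

lemma kron_mult:
  assumes A: "A \<in> carrier_mat a b" and B: "B \<in> carrier_mat c d"
    and C: "C \<in> carrier_mat b e" and D: "D \<in> carrier_mat d f"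
  shows "kron A B * kron C D = kron (A * C) (B * D)"
proof (rule eq_matI)
  fix r s assume "r < dim_row (kron (A * C) (B * D))" "s < dim_col (kron (A * C) (B * D))"
  then have r: "r < a * c" and s: "s < e * f" using assms by (auto simp: kron_def)
  note rd = div_mod_less[OF r] and sd = div_mod_less[OF s]
  have "(kron A B * kron C D) $$ (r, s) = (\<Sum>k<b * d. kron A B $$ (r, k) * kron C D $$ (k, s))"
    using r s kron_carrier[OF A B] kron_carrier[OF C D]
    by (simp add: scalar_prod_def lessThan_atLeast0)
  also have "\<dots> = (\<Sum>j<b. \<Sum>i<d. (A $$ (r div c, j) * C $$ (j, s div f)) *
      (B $$ (r mod c, i) * D $$ (i, s mod f)))"
    unfolding sum_lessThan_mult using r s assms
    by (intro sum.cong refl) (simp add: index_kron block_index_less)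
  also have "\<dots> = (\<Sum>j<b. A $$ (r div c, j) * C $$ (j, s div f)) *
      (\<Sum>i<d. B $$ (r mod c, i) * D $$ (i, s mod f))"
    by (rule sum_product[symmetric])
  also have "\<dots> = (A * C) $$ (r div c, s div f) * (B * D) $$ (r mod c, s mod f)"
    using rd sd assms by (simp add: scalar_prod_def lessThan_atLeast0)
  also have "\<dots> = kron (A * C) (B * D) $$ (r, s)"
    using r s assms by (subst index_kron) auto
  finally show "(kron A B * kron C D) $$ (r, s) = kron (A * C) (B * D) $$ (r, s)" .
qed (use assms in \<open>auto simp: kron_def\<close>)

lemma transpose_kron: "transpose_mat (kron A B) = kron (transpose_mat A) (transpose_mat B)"
proof (rule eq_matI)
  fix r s assume "r < dim_row (kron (transpose_mat A) (transpose_mat B))"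
    "s < dim_col (kron (transpose_mat A) (transpose_mat B))"
  then have r: "r < dim_col A * dim_col B" and s: "s < dim_row A * dim_row B"
    by (auto simp: kron_def)
  show "transpose_mat (kron A B) $$ (r, s) = kron (transpose_mat A) (transpose_mat B) $$ (r, s)"
    using r s div_mod_less[OF r] div_mod_less[OF s] by (simp add: kron_def)
qed (auto simp: kron_def)

lemma kron_add_left:
  assumes "A \<in> carrier_mat a b" "A' \<in> carrier_mat a b" "B \<in> carrier_mat c d"
  shows "kron (A + A') B = kron A B + kron A' B"
  using assms by (intro eq_matI)
    (auto simp: kron_def div_mod_less algebra_simps)

lemma kron_add_right:
  assumes "A \<in> carrier_mat a b" "B \<in> carrier_mat c d" "B' \<in> carrier_mat c d"
  shows "kron A (B + B') = kron A B + kron A B'"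
proof (rule eq_matI)
  fix r s assume "r < dim_row (kron A B + kron A B')" "s < dim_col (kron A B + kron A B')"
  then have r: "r < a * c" and s: "s < b * d" using assms by (auto simp: kron_def)
  show "kron A (B + B') $$ (r, s) = (kron A B + kron A B') $$ (r, s)"
    using r s div_mod_less[OF r] div_mod_less[OF s] assms
    by (simp add: kron_def algebra_simps)
qed (use assms in \<open>auto simp: kron_def\<close>)

lemma kron_diff_left:
  assumes "A \<in> carrier_mat a b" "A' \<in> carrier_mat a b" "B \<in> carrier_mat c d"
  shows "kron (A - A') B = kron A B - kron A' B"
  using assms by (intro eq_matI)
    (auto simp: kron_def div_mod_less algebra_simps)

lemma kron_diff_right:
  assumes "A \<in> carrier_mat a b" "B \<in> carrier_mat c d" "B' \<in> carrier_mat c d"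
  shows "kron A (B - B') = kron A B - kron A B'"
proof (rule eq_matI)
  fix r s assume "r < dim_row (kron A B - kron A B')" "s < dim_col (kron A B - kron A B')"
  then have r: "r < a * c" and s: "s < b * d" using assms by (auto simp: kron_def)
  show "kron A (B - B') $$ (r, s) = (kron A B - kron A B') $$ (r, s)"
    using r s div_mod_less[OF r] div_mod_less[OF s] assms
    by (simp add: kron_def algebra_simps)
qed (use assms in \<open>auto simp: kron_def\<close>)

lemma kron_one: "kron (1\<^sub>m n) (1\<^sub>m m) = 1\<^sub>m (n * m)"
proof (rule eq_matI)
  fix r s assume "r < dim_row (1\<^sub>m (n * m))" "s < dim_col (1\<^sub>m (n * m))"
  then have r: "r < n * m" and s: "s < n * m" by auto
  have "r = s \<longleftrightarrow> r div m = s div m \<and> r mod m = s mod m"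
    by (metis div_mult_mod_eq)
  then show "kron (1\<^sub>m n) (1\<^sub>m m) $$ (r, s) = 1\<^sub>m (n * m) $$ (r, s)"
    using r s div_mod_less[OF r] div_mod_less[OF s] by (auto simp: kron_def)
qed (auto simp: kron_def)

section \<open>Bilinear forms and their matrices\<close>

lemma mult_mat_vec_scalar_prod:
  fixes A :: "real mat"
  assumes "A \<in> carrier_mat m n" "u \<in> carrier_vec n" "w \<in> carrier_vec m"
  shows "scalar_prod (A *\<^sub>v u) w = scalar_prod u (transpose_mat A *\<^sub>v w)"
proof -
  have "scalar_prod u (transpose_mat A *\<^sub>v w) = scalar_prod (transpose_mat A *\<^sub>v w) u"
    using assms by (intro comm_scalar_prod[of _ n]) auto
  also have "\<dots> = scalar_prod w (A *\<^sub>v u)"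
    using assms transpose_vec_mult_scalar[of A m n u w] by simp
  also have "\<dots> = scalar_prod (A *\<^sub>v u) w"
    using assms by (intro comm_scalar_prod[of _ m]) auto
  finally show ?thesis by simp
qed

lemma congruence_carrier:
  fixes A E :: "real mat"
  assumes "E \<in> carrier_mat m d" "A \<in> carrier_mat m m"
  shows "transpose_mat E * A * E \<in> carrier_mat d d"
  using assms by simp

lemma transpose_congruence:
  fixes A E :: "real mat"
  assumes "E \<in> carrier_mat m d" "A \<in> carrier_mat m m"
  shows "transpose_mat (transpose_mat E * A * E) = transpose_mat E * transpose_mat A * E"
  using assms by (simp add: transpose_mult[of _ m m _ d] transpose_mult[of _ d m _ d]
      assoc_mult_mat[of _ d m _ m _ d])

lemma add_transpose_sum:
  fixes A B :: "real mat"
  assumes "A \<in> carrier_mat n n" "B \<in> carrier_mat n n"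
  shows "(A + B) + transpose_mat (A + B) = (A + transpose_mat A) + (B + transpose_mat B)"
  using assms by (intro eq_matI) auto

lemma congruence_add_transpose:
  fixes A E :: "real mat"
  assumes "E \<in> carrier_mat m d" "A \<in> carrier_mat m m"
  shows "transpose_mat E * A * E + transpose_mat (transpose_mat E * A * E)
    = transpose_mat E * (A + transpose_mat A) * E"
  unfolding transpose_congruence[OF assms]
  using assms by (simp add: mult_add_distrib_mat[of _ d m] add_mult_distrib_mat[of _ d m])

lemma ip_mult_right:
  assumes "H \<in> carrier_mat n m" "D \<in> carrier_mat m k" "v \<in> carrier_vec k"
  shows "ip H u (D *\<^sub>v v) = ip (H * D) u v"
  using assms by (simp add: ip_def)

lemma ip_mult_left:
  assumes "D \<in> carrier_mat n k" "H \<in> carrier_mat n m" "u \<in> carrier_vec k" "v \<in> carrier_vec m"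
  shows "ip H (D *\<^sub>v u) v = ip (transpose_mat D * H) u v"
  using assms by (simp add: ip_def mult_mat_vec_scalar_prod[of _ n k])

lemma ip_congruence:
  assumes "E \<in> carrier_mat m d" "A \<in> carrier_mat m m" "u \<in> carrier_vec d" "v \<in> carrier_vec d"
  shows "ip (transpose_mat E * A * E) u v = ip A (E *\<^sub>v u) (E *\<^sub>v v)"
proof -
  have "ip A (E *\<^sub>v u) (E *\<^sub>v v) = ip (transpose_mat E * A) u (E *\<^sub>v v)"
    using assms by (intro ip_mult_left) auto
  also have "\<dots> = ip (transpose_mat E * A * E) u v"
    using assms by (intro ip_mult_right) auto
  finally show ?thesis by simp
qed

lemma ip_add_mat:
  assumes "A \<in> carrier_mat n n" "B \<in> carrier_mat n n" "u \<in> carrier_vec n" "v \<in> carrier_vec n"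
  shows "ip (A + B) u v = ip A u v + ip B u v"
  using assms by (simp add: ip_def add_mult_distrib_mat_vec scalar_prod_add_distrib[of _ n])

lemma ip_diff_mat:
  assumes "A \<in> carrier_mat n n" "B \<in> carrier_mat n n" "u \<in> carrier_vec n" "v \<in> carrier_vec n"
  shows "ip (A - B) u v = ip A u v - ip B u v"
  using assms by (simp add: ip_def minus_mult_distrib_mat_vec scalar_prod_minus_distrib[of _ n])

text \<open>This lets identities between matrices be checked on vectors, where extraction matrices act by
  picking components.\<close>

lemma ip_determines_mat:
  assumes "A \<in> carrier_mat n n" "B \<in> carrier_mat n n"
    and "\<And>u v. u \<in> carrier_vec n \<Longrightarrow> v \<in> carrier_vec n \<Longrightarrow> ip A u v = ip B u v"
  shows "A = B"
proof (rule eq_matI)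
  fix i j assume "i < dim_row B" "j < dim_col B"
  then have ij: "i < n" "j < n" using assms by auto
  have "ip C (unit_vec n i) (unit_vec n j) = C $$ (i, j)" if "C \<in> carrier_mat n n" for C
  proof -
    have "C *\<^sub>v unit_vec n j = col C j"
      using that ij by (intro eq_vecI) auto
    then show ?thesis using that ij by (simp add: ip_def)
  qed
  then show "A $$ (i, j) = B $$ (i, j)" using assms by (metis unit_vec_carrier)
qed (use assms in auto)

lemma ip_sum:
  assumes "A \<in> carrier_mat n n" "u \<in> carrier_vec n" "v \<in> carrier_vec n"
  shows "ip A u v = (\<Sum>i<n. \<Sum>j<n. A $$ (i, j) * u $ i * v $ j)"
  using assms
  by (auto simp: ip_def scalar_prod_def lessThan_atLeast0 sum_distrib_left algebra_simps
      intro!: sum.cong)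

lemma ip_kron:
  assumes "A \<in> carrier_mat n n" "B \<in> carrier_mat m m"
    "u \<in> carrier_vec (n * m)" "v \<in> carrier_vec (n * m)"
  shows "ip (kron A B) u v = (\<Sum>j<n. \<Sum>i<m. \<Sum>j'<n. \<Sum>i'<m.
    A $$ (j, j') * B $$ (i, i') * u $ (j * m + i) * v $ (j' * m + i'))"
  using assms
  by (simp add: ip_sum[of _ "n * m"] sum_lessThan_mult index_kron_block)

lemma ip_bilinear_square:
  assumes "A \<in> carrier_mat n n" "transpose_mat A = A" "u \<in> carrier_vec n" "v \<in> carrier_vec n"
  shows "ip A (u - v) (u - v) = ip A u u - 2 * ip A v u + ip A v v"
proof -
  have sym: "ip A u v = ip A v u"
  proof -
    have "ip A v u = scalar_prod (A *\<^sub>v u) v" unfolding ip_def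
      using assms by (intro comm_scalar_prod[of _ n]) auto
    also have "\<dots> = ip A u v" unfolding ip_def
      using assms by (subst mult_mat_vec_scalar_prod[of A n n]) auto
    finally show ?thesis by simp
  qed
  have "ip A (u - v) (u - v) = ip A u u - ip A u v - (ip A v u - ip A v v)"
    using assms by (simp add: ip_def mult_minus_distrib_mat_vec minus_scalar_prod_distrib[of _ n]
       scalar_prod_minus_distrib[of _ n])
  then show ?thesis using sym by simp
qed

section \<open>Positive definite matrices\<close>

text \<open>Cholesky factorisation by bordering: eliminating the last variable leaves the Schur complement
  \<open>S\<close>, which is again positive definite because its quadratic form is the minimum of the original one
  over the last coordinate. A factor of \<open>S\<close> extended by the row \<open>A\<^sub>i\<^sub>n / \<surd>a\<close>, with \<open>a\<close> the last diagonal
  entry, is a factor of \<open>A\<close>.\<close>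

lemma positive_definite_gram_fun:
  fixes A :: "nat \<Rightarrow> nat \<Rightarrow> real"
  assumes "\<And>i j. i < n \<Longrightarrow> j < n \<Longrightarrow> A i j = A j i"
    and "\<And>c. \<exists>j<n. c j \<noteq> 0 \<Longrightarrow> (\<Sum>i<n. \<Sum>j<n. A i j * c i * c j) > 0"
  shows "\<exists>L. \<forall>i<n. \<forall>j<n. A i j = (\<Sum>k<n. L k i * L k j)"
  using assms
proof (induction n arbitrary: A)
  case 0
  then show ?case by simp
next
  case (Suc n)
  define a where "a = A n n"
  have a: "a > 0"
  proof -
    have "(\<Sum>i<Suc n. \<Sum>j<Suc n. A i j * (if i = n then 1 else 0) * (if j = n then 1 else 0)) > 0"
      by (rule Suc.prems(2)) auto
    moreover have "(\<Sum>i<Suc n. \<Sum>j<Suc n. A i j * (if i = n then 1 else 0) * (if j = n then 1 else 0)) = a"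
      by (simp add: a_def)
    ultimately show ?thesis by simp
  qed
  define S where "S i j = A i j - A i n * A j n / a" for i j
  have "\<exists>L. \<forall>i<n. \<forall>j<n. S i j = (\<Sum>k<n. L k i * L k j)"
  proof (rule Suc.IH)
    fix i j assume "i < n" "j < n"
    then show "S i j = S j i" using Suc.prems(1) by (simp add: S_def)
  next
    fix c :: "nat \<Rightarrow> real" assume c: "\<exists>j<n. c j \<noteq> 0"
    define s where "s = (\<Sum>j<n. A j n * c j)"
    \<comment> \<open>the minimiser of the quadratic form in the last coordinate\<close>
    define x where "x = - s / a"
    define c' where "c' = c(n := x)"
    have s': "(\<Sum>j<n. A n j * c j) = s"
      unfolding s_def using Suc.prems(1) by (intro sum.cong) auto
    have "0 < (\<Sum>i<Suc n. \<Sum>j<Suc n. A i j * c' i * c' j)"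
    proof (rule Suc.prems(2))
      from c obtain j where "j < n" "c j \<noteq> 0" by blast
      then show "\<exists>j<Suc n. c' j \<noteq> 0" by (intro exI[of _ j]) (simp add: c'_def)
    qed
    also have "\<dots> = (\<Sum>i<n. \<Sum>j<n. A i j * c i * c j) + (\<Sum>i<n. A i n * c i * x)
        + ((\<Sum>j<n. A n j * x * c j) + a * x * x)"
      by (simp add: c'_def a_def sum.distrib)
    also have "(\<Sum>i<n. A i n * c i * x) = s * x"
      by (simp add: s_def sum_distrib_right)
    also have "(\<Sum>j<n. A n j * x * c j) = s * x"
      unfolding s'[symmetric] sum_distrib_right by (simp add: mult_ac)
    also have "(\<Sum>i<n. \<Sum>j<n. A i j * c i * c j) + s * x + (s * x + a * x * x)
        = (\<Sum>i<n. \<Sum>j<n. A i j * c i * c j) - s * s / a"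
      using a by (simp add: x_def field_simps)
    also have "s * s / a = (\<Sum>i<n. \<Sum>j<n. (A i n * A j n / a) * c i * c j)"
      unfolding s_def sum_product sum_divide_distrib by (simp add: algebra_simps)
    also have "(\<Sum>i<n. \<Sum>j<n. A i j * c i * c j) - \<dots> = (\<Sum>i<n. \<Sum>j<n. S i j * c i * c j)"
      by (simp add: S_def sum_subtractf algebra_simps)
    finally show "(\<Sum>i<n. \<Sum>j<n. S i j * c i * c j) > 0" .
  qed
  then obtain L where L: "\<And>i j. i < n \<Longrightarrow> j < n \<Longrightarrow> S i j = (\<Sum>k<n. L k i * L k j)"
    by blast
  define L' where
    "L' k i = (if k = n then A i n / sqrt a else if i < n then L k i else 0)" for k i
  have "A i j = (\<Sum>k<Suc n. L' k i * L' k j)" if "i < Suc n" "j < Suc n" for i j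
  proof -
    have "(\<Sum>k<n. L' k i * L' k j) = (if i < n \<and> j < n then S i j else 0)"
      using L by (auto simp: L'_def intro!: sum.cong sum.neutral)
    moreover have "L' n i * L' n j = A i n * A j n / a"
      using a by (simp add: L'_def)
    moreover have "A n j = A j n" using that Suc.prems(1) by simp
    ultimately show ?thesis
      using that a by (auto simp: S_def a_def less_Suc_eq)
  qed
  then show ?case by blast
qed

lemma spd_gram:
  assumes "spd n A"
  shows "\<exists>L \<in> carrier_mat n n. A = transpose_mat L * L"
proof -
  have A: "A \<in> carrier_mat n n" and sym: "transpose_mat A = A"
    and pos: "\<And>v. v \<in> carrier_vec n \<Longrightarrow> v \<noteq> 0\<^sub>v n \<Longrightarrow> ip A v v > 0"
    using assms by (auto simp: spd_def ip_def)
  have "\<exists>L. \<forall>i<n. \<forall>j<n. A $$ (i, j) = (\<Sum>k<n. L k i * L k j)"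
  proof (rule positive_definite_gram_fun)
    fix i j assume "i < n" "j < n"
    then show "A $$ (i, j) = A $$ (j, i)"
      using A sym by (metis carrier_matD index_transpose_mat(1))
  next
    fix c :: "nat \<Rightarrow> real" assume "\<exists>j<n. c j \<noteq> 0"
    then have "vec n c \<noteq> 0\<^sub>v n" by (metis index_vec index_zero_vec(1))
    then have "ip A (vec n c) (vec n c) > 0" by (intro pos) auto
    also have "ip A (vec n c) (vec n c) = (\<Sum>i<n. \<Sum>j<n. A $$ (i, j) * c i * c j)"
      using A by (simp add: ip_sum[of _ n])
    finally show "(\<Sum>i<n. \<Sum>j<n. A $$ (i, j) * c i * c j) > 0" .
  qed
  then obtain L where L: "\<And>i j. i < n \<Longrightarrow> j < n \<Longrightarrow> A $$ (i, j) = (\<Sum>k<n. L k i * L k j)"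
    by blast
  have "A = transpose_mat (mat n n (\<lambda>(k, i). L k i)) * mat n n (\<lambda>(k, i). L k i)"
    using A by (intro eq_matI) (auto simp: L scalar_prod_def lessThan_atLeast0)
  then show ?thesis by (intro bexI) auto
qed

lemma spd_inverse:
  assumes "spd n A"
  shows "the (mat_inverse A) \<in> carrier_mat n n"
    and "A * the (mat_inverse A) = 1\<^sub>m n"
    and "the (mat_inverse A) * A = 1\<^sub>m n"
proof -
  have A: "A \<in> carrier_mat n n" using assms by (simp add: spd_def)
  have "A *\<^sub>v v \<noteq> 0\<^sub>v n" if "v \<in> carrier_vec n" "v \<noteq> 0\<^sub>v n" for v
    using assms that by (auto simp: spd_def)
  then have "det A \<noteq> 0" using det_0_iff_vec_prod_zero_field[OF A] by blast
  then have "A \<in> Units (ring_mat TYPE(real) n ())" by (rule det_non_zero_imp_unit[OF A])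
  then obtain B where "mat_inverse A = Some B"
    using mat_inverse(1)[OF A, where b = "()"] by (cases "mat_inverse A") auto
  then show "the (mat_inverse A) \<in> carrier_mat n n"
    "A * the (mat_inverse A) = 1\<^sub>m n" "the (mat_inverse A) * A = 1\<^sub>m n"
    using mat_inverse(2)[OF A] by auto
qed

text \<open>With \<open>A = L\<^sup>T L\<close> and \<open>B = M\<^sup>T M\<close> the mixed-product rule makes \<open>A \<otimes> B\<close> the Gram matrix of
  \<open>K = L \<otimes> M\<close>, so its form is \<open>\<parallel>K v\<parallel>\<^sup>2\<close>. It vanishes only for \<open>v = 0\<close>, because \<open>A \<otimes> B\<close> has the inverse
  \<open>A\<^sup>-\<^sup>1 \<otimes> B\<^sup>-\<^sup>1\<close>.\<close>

lemma spd_kron: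
  assumes "spd n A" "spd m B"
  shows "spd (n * m) (kron A B)"
proof -
  have A: "A \<in> carrier_mat n n" "transpose_mat A = A"
    and B: "B \<in> carrier_mat m m" "transpose_mat B = B" using assms by (auto simp: spd_def)
  obtain L where L: "L \<in> carrier_mat n n" "A = transpose_mat L * L"
    using spd_gram[OF assms(1)] by blast
  obtain M where M: "M \<in> carrier_mat m m" "B = transpose_mat M * M"
    using spd_gram[OF assms(2)] by blast
  let ?K = "kron L M"
  have K: "?K \<in> carrier_mat (n * m) (n * m)" using L(1) M(1) by simp
  have gram: "kron A B = transpose_mat ?K * ?K"
    unfolding transpose_kron L(2) M(2)
    by (rule kron_mult[symmetric]) (use L M in auto)
  have "scalar_prod v (kron A B *\<^sub>v v) > 0" if v: "v \<in> carrier_vec (n * m)" "v \<noteq> 0\<^sub>v (n * m)" for v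
  proof -
    let ?w = "?K *\<^sub>v v"
    have w: "?w \<in> carrier_vec (n * m)" using K v by simp
    have "scalar_prod v (kron A B *\<^sub>v v) = scalar_prod ?w ?w"
      unfolding gram using K v by (simp add: mult_mat_vec_scalar_prod[of _ "n*m" "n*m"])
    moreover have "?w \<noteq> 0\<^sub>v (n * m)"
    proof
      assume w0: "?w = 0\<^sub>v (n * m)"
      have "kron A B *\<^sub>v v = transpose_mat ?K *\<^sub>v ?w"
        unfolding gram using K v by (intro assoc_mult_mat_vec) auto
      then have AB0: "kron A B *\<^sub>v v = 0\<^sub>v (n * m)" using w0 K by auto
      let ?A' = "the (mat_inverse A)" and ?B' = "the (mat_inverse B)"
      have "kron ?A' ?B' * kron A B = 1\<^sub>m (n * m)"
        using kron_mult[OF spd_inverse(1)[OF assms(1)] spd_inverse(1)[OF assms(2)] A(1) B(1)]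
        by (simp add: spd_inverse[OF assms(1)] spd_inverse[OF assms(2)] kron_one)
      then have "v = (kron ?A' ?B' * kron A B) *\<^sub>v v" using v by simp
      also have "\<dots> = kron ?A' ?B' *\<^sub>v (kron A B *\<^sub>v v)"
        using v A B spd_inverse(1)[OF assms(1)] spd_inverse(1)[OF assms(2)]
        by (intro assoc_mult_mat_vec[of _ "n * m" "n * m" _ "n * m"]) auto
      also have "\<dots> = 0\<^sub>v (n * m)"
        using AB0 kron_carrier[OF spd_inverse(1)[OF assms(1)] spd_inverse(1)[OF assms(2)]] by auto
      finally show False using v by simp
    qed
    moreover have "scalar_prod x x \<ge> 0" "scalar_prod x x = 0 \<Longrightarrow> x = 0\<^sub>v (n * m)"
      if "x \<in> carrier_vec (n * m)" for x :: "real vec"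
      using that by (auto simp: scalar_prod_def sum_nonneg sum_nonneg_eq_0_iff)
    ultimately show ?thesis using w by fastforce
  qed
  then show ?thesis using A B by (simp add: spd_def transpose_kron)
qed

lemma spd_ip_nonneg:
  assumes "spd n W" "v \<in> carrier_vec n"
  shows "ip W v v \<ge> 0"
proof (cases "v = 0\<^sub>v n")
  case True
  then show ?thesis using assms by (auto simp: spd_def ip_def)
next
  case False
  then show ?thesis using assms by (auto simp: spd_def ip_def less_imp_le)
qed

section \<open>The weighted pseudoinverse of an injective map\<close>

text \<open>The weighted least-squares solution operator: it sends \<open>w\<close> to the minimiser \<open>x\<close> of the
  \<open>W\<close>-norm of \<open>w - E x\<close>. For injective \<open>E\<close> and positive definite \<open>W\<close> it is the Moore--Penrose inverse.\<close>

definition weighted_left_inverse :: "real mat \<Rightarrow> real mat \<Rightarrow> real mat" where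
  "weighted_left_inverse W E = the (mat_inverse (transpose_mat E * W * E)) * transpose_mat E * W"

lemma spd_congruence:
  assumes "spd n W" "E \<in> carrier_mat n d"
    and "\<And>v. v \<in> carrier_vec d \<Longrightarrow> E *\<^sub>v v = 0\<^sub>v n \<Longrightarrow> v = 0\<^sub>v d"
  shows "spd d (transpose_mat E * W * E)"
proof -
  have W: "W \<in> carrier_mat n n" "transpose_mat W = W" using assms by (auto simp: spd_def)
  have "transpose_mat (transpose_mat E * W * E) = transpose_mat E * W * E"
    using transpose_congruence[OF assms(2) W(1)] W(2) by simp
  moreover have "ip (transpose_mat E * W * E) v v > 0"
    if "v \<in> carrier_vec d" "v \<noteq> 0\<^sub>v d" for v
  proof -
    have "E *\<^sub>v v \<in> carrier_vec n" "E *\<^sub>v v \<noteq> 0\<^sub>v n" using assms that by auto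
    then have "ip W (E *\<^sub>v v) (E *\<^sub>v v) > 0" using assms(1) by (simp add: spd_def ip_def)
    then show ?thesis using ip_congruence[OF assms(2) W(1)] that by simp
  qed
  ultimately show ?thesis using assms(2) W by (simp add: spd_def ip_def)
qed

context
  fixes n d :: nat and W E :: "real mat"
  assumes W: "spd n W" and E: "E \<in> carrier_mat n d"
    and H: "spd d (transpose_mat E * W * E)"
begin

private abbreviation "H \<equiv> transpose_mat E * W * E"
private abbreviation "X \<equiv> weighted_left_inverse W E"

private lemma Wc: "W \<in> carrier_mat n n" "transpose_mat W = W"
  using W by (auto simp: spd_def)

lemma weighted_left_inverse_carrier: "X \<in> carrier_mat d n"
  using spd_inverse(1)[OF H] E Wc by (simp add: weighted_left_inverse_def)

lemma weighted_left_inverse_normal_eq: "H * X = transpose_mat E * W"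
proof -
  have "H * X = H * (the (mat_inverse H) * (transpose_mat E * W))"
    unfolding weighted_left_inverse_def
    using assoc_mult_mat[OF spd_inverse(1)[OF H], of "transpose_mat E" n W n] E Wc by simp
  also have "\<dots> = (H * the (mat_inverse H)) * (transpose_mat E * W)"
    using spd_inverse(1)[OF H] E Wc by (intro assoc_mult_mat[symmetric, of _ d d _ d _ n]) auto
  also have "\<dots> = transpose_mat E * W"
    using spd_inverse(2)[OF H] E Wc by simp
  finally show ?thesis .
qed

lemma weighted_left_inverse_unique:
  assumes "Y \<in> carrier_mat d n" "H * Y = transpose_mat E * W"
  shows "Y = X"
proof -
  have inv: "Z = the (mat_inverse H) * (H * Z)" if "Z \<in> carrier_mat d n" for Z
  proof -
    have "the (mat_inverse H) * (H * Z) = (the (mat_inverse H) * H) * Z"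
      using spd_inverse(1)[OF H] that E Wc
      by (intro assoc_mult_mat[symmetric, of _ d d _ d _ n]) auto
    then show ?thesis using spd_inverse(3)[OF H] that by simp
  qed
  show ?thesis
    using inv[OF assms(1)] inv[OF weighted_left_inverse_carrier] assms(2)
      weighted_left_inverse_normal_eq by simp
qed

lemma weighted_left_inverse_mult: "X * E = 1\<^sub>m d"
proof -
  have "X * E = the (mat_inverse H) * H"
    unfolding weighted_left_inverse_def
    using spd_inverse(1)[OF H] E Wc
    by (simp add: assoc_mult_mat[of _ d d _ n _ n] assoc_mult_mat[of _ d d _ n _ d]
        assoc_mult_mat[of _ d n _ n _ d])
  then show ?thesis using spd_inverse(3)[OF H] by simp
qed

text \<open>Both sides equal \<open>X\<^sup>T H X\<close>: transposing the normal equation gives \<open>X\<^sup>T H = W E\<close>.\<close>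

lemma weighted_projection_symmetric:
  "transpose_mat (E * X) * W = W * (E * X)"
proof -
  note X = weighted_left_inverse_carrier
  have "transpose_mat X * H = W * E"
  proof -
    have "transpose_mat (H * X) = transpose_mat X * H"
      using H X E Wc by (subst transpose_mult[of _ d d _ n]) (auto simp: spd_def)
    moreover have "transpose_mat (transpose_mat E * W) = W * E"
      using E Wc by (subst transpose_mult[of _ d n _ n]) auto
    ultimately show ?thesis using weighted_left_inverse_normal_eq by simp
  qed
  have "transpose_mat (E * X) * W = transpose_mat X * (transpose_mat E * W)"
    using E X Wc by (simp add: transpose_mult[of _ n d _ n] assoc_mult_mat[of _ n d _ n _ n])
  also have "\<dots> = transpose_mat X * (H * X)" by (simp add: weighted_left_inverse_normal_eq)
  also have "\<dots> = (transpose_mat X * H) * X"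
    using E X Wc by (intro assoc_mult_mat[symmetric, of _ n d _ d _ n]) auto
  also have "\<dots> = W * (E * X)"
    using \<open>transpose_mat X * H = W * E\<close> E X Wc by (simp add: assoc_mult_mat[of _ n n _ d _ n])
  finally show ?thesis .
qed

lemma weighted_left_inverse_is_mp: "is_mp_inverse H W E X"
proof -
  note X = weighted_left_inverse_carrier
  have "E * X * E = E"
    using E X weighted_left_inverse_mult by (simp add: assoc_mult_mat[of _ n d _ n _ d])
  moreover have "X * E * X = X" using X weighted_left_inverse_mult by simp
  moreover have "ip W ((E * X) *\<^sub>v u) v = ip W u ((E * X) *\<^sub>v v)"
    if "u \<in> carrier_vec n" "v \<in> carrier_vec n" for u v
  proof -
    have "ip W ((E * X) *\<^sub>v u) v = ip (transpose_mat (E * X) * W) u v"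
      using that E X Wc by (intro ip_mult_left[of _ n n _ n]) auto
    also have "\<dots> = ip W u ((E * X) *\<^sub>v v)"
      unfolding weighted_projection_symmetric
      using that E X Wc by (intro ip_mult_right[symmetric, of _ n n _ n]) auto
    finally show ?thesis .
  qed
  ultimately show ?thesis
    using E X by (auto simp: is_mp_inverse_def weighted_left_inverse_mult)
qed

text \<open>Self-adjointness of \<open>E Y\<close> moves the weight across, and then \<open>E Y E = E\<close> absorbs the projection:
  \<open>E\<^sup>T W E Y = E\<^sup>T (E Y)\<^sup>T W = (E Y E)\<^sup>T W = E\<^sup>T W\<close>. As \<open>H\<close> is invertible, this determines \<open>Y\<close>, which is
  why the pseudoinverse is unique.\<close>

lemma mp_inverse_is_normal_eq:
  assumes "is_mp_inverse H W E Y"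
  shows "H * Y = transpose_mat E * W"
proof -
  have Y: "Y \<in> carrier_mat d n" and EYE: "E * Y * E = E"
    and adj: "\<And>u v. u \<in> carrier_vec n \<Longrightarrow> v \<in> carrier_vec n \<Longrightarrow>
      ip W ((E * Y) *\<^sub>v u) v = ip W u ((E * Y) *\<^sub>v v)"
    using assms E by (auto simp: is_mp_inverse_def)
  have EY: "E * Y \<in> carrier_mat n n" using E Y by simp
  have sym: "transpose_mat (E * Y) * W = W * (E * Y)"
  proof (rule ip_determines_mat)
    fix u v :: "real vec" assume uv: "u \<in> carrier_vec n" "v \<in> carrier_vec n"
    show "ip (transpose_mat (E * Y) * W) u v = ip (W * (E * Y)) u v"
      using adj[OF uv] ip_mult_left[OF EY Wc(1) uv] ip_mult_right[OF Wc(1) EY uv(2), of u] by simp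
  qed (use EY Wc in auto)
  have "H * Y = transpose_mat E * (W * (E * Y))"
    using E Y Wc
    by (simp add: assoc_mult_mat[of _ d n _ n _ n] assoc_mult_mat[of _ d n _ n _ d]
      assoc_mult_mat[of _ d n _ d _ n] assoc_mult_mat[of _ n n _ d _ n])
  also have "\<dots> = transpose_mat E * (transpose_mat (E * Y) * W)" by (simp only: sym)
  also have "\<dots> = (transpose_mat E * transpose_mat (E * Y)) * W"
    using E EY Wc by (intro assoc_mult_mat[symmetric, of _ d n _ n _ n]) auto
  also have "transpose_mat E * transpose_mat (E * Y) = transpose_mat (E * Y * E)"
    using E EY by (subst transpose_mult[of "E * Y" n n E d]) auto
  finally show ?thesis by (simp only: EYE)
qed

lemma mp_inverse_eq_weighted_left_inverse: "mp_inverse H W E = X"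
  unfolding mp_inverse_def
proof (rule the_equality)
  show "is_mp_inverse H W E X" by (rule weighted_left_inverse_is_mp)
next
  fix Y assume "is_mp_inverse H W E Y"
  moreover from this have "Y \<in> carrier_mat d n" using E by (auto simp: is_mp_inverse_def)
  ultimately show "Y = X"
    using weighted_left_inverse_unique mp_inverse_is_normal_eq by blast
qed

text \<open>The \<open>H\<close>-norm of \<open>X w\<close> is the \<open>W\<close>-norm of the orthogonal projection \<open>E X w\<close> of \<open>w\<close>; the gap
  between the two sides is the squared \<open>W\<close>-norm of \<open>w - E X w\<close>.\<close>

lemma weighted_left_inverse_contraction:
  assumes w: "w \<in> carrier_vec n"
  shows "ip H (X *\<^sub>v w) (X *\<^sub>v w) \<le> ip W w w"
proof -
  note X = weighted_left_inverse_carrier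
  let ?q = "ip H (X *\<^sub>v w) (X *\<^sub>v w)" and ?z = "E *\<^sub>v (X *\<^sub>v w)"
  have Xw: "X *\<^sub>v w \<in> carrier_vec d" and z: "?z \<in> carrier_vec n" using E X w by auto
  have "?q = ip (H * X) (X *\<^sub>v w) w"
    using w X E Wc by (intro ip_mult_right[of _ d d]) auto
  also have "\<dots> = ip W ?z w"
    unfolding weighted_left_inverse_normal_eq
    using ip_mult_left[OF E Wc(1) Xw w] by simp
  finally have 1: "?q = ip W ?z w" .
  have 2: "?q = ip W ?z ?z" by (rule ip_congruence[OF E Wc(1) Xw Xw])
  have "0 \<le> ip W (w - ?z) (w - ?z)" using W w z by (intro spd_ip_nonneg) auto
  also have "\<dots> = ip W w w - 2 * ip W ?z w + ip W ?z ?z"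
    by (rule ip_bilinear_square[OF Wc w z])
  finally show ?thesis using 1 2 by simp
qed

end

section \<open>Summation by parts as a matrix identity\<close>

text \<open>The matrix unit in diagonal position \<open>i\<close>; its bilinear form evaluates both arguments at \<open>i\<close>, so
  boundary terms are differences of such matrices.\<close>

definition diag_unit :: "nat \<Rightarrow> nat \<Rightarrow> real mat" where
  "diag_unit n i = mat n n (\<lambda>(r, c). if r = i \<and> c = i then 1 else 0)"

lemma diag_unit_carrier [simp]: "diag_unit n i \<in> carrier_mat n n"
  by (simp add: diag_unit_def)

lemma index_diag_unit:
  "r < n \<Longrightarrow> c < n \<Longrightarrow>
    diag_unit n i $$ (r, c) = (if r = i then 1 else 0) * (if c = i then 1 else 0)"
  by (simp add: diag_unit_def)

lemma sum_select:
  fixes f :: "nat \<Rightarrow> real"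
  assumes "i < n"
  shows "(\<Sum>r<n. (if r = i then 1 else 0) * f r) = f i"
proof -
  have "(\<Sum>r<n. (if r = i then 1 else 0) * f r) = (\<Sum>r<n. if r = i then f r else 0)"
    by (intro sum.cong) auto
  then show ?thesis using assms by simp
qed

lemma ip_diag_unit:
  assumes "u \<in> carrier_vec n" "v \<in> carrier_vec n" "i < n"
  shows "ip (diag_unit n i) u v = u $ i * v $ i"
proof -
  have "ip (diag_unit n i) u v =
      (\<Sum>r<n. \<Sum>c<n. diag_unit n i $$ (r, c) * u $ r * v $ c)"
    using assms by (intro ip_sum) auto
  also have "\<dots> = (\<Sum>r<n. \<Sum>c<n. (if r = i then 1 else 0) * ((if c = i then 1 else 0) * (u $ r * v $ c)))"
    by (intro sum.cong refl) (simp only: index_diag_unit lessThan_iff mult.assoc)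
  also have "\<dots> = u $ i * v $ i"
    by (simp only: sum_distrib_left[symmetric] sum_select[OF assms(3)])
  finally show ?thesis .
qed

lemma ip_kron_diag_unit_right:
  assumes "A \<in> carrier_mat n n" "u \<in> carrier_vec (n * m)" "v \<in> carrier_vec (n * m)" "i < m"
  shows "ip (kron A (diag_unit m i)) u v =
    ip A (vec n (\<lambda>j. u $ (j * m + i))) (vec n (\<lambda>j. v $ (j * m + i)))"
proof -
  have "ip (kron A (diag_unit m i)) u v = (\<Sum>j<n. \<Sum>r<m. \<Sum>j'<n. \<Sum>c<m.
     A $$ (j, j') * diag_unit m i $$ (r, c) * u $ (j * m + r) * v $ (j' * m + c))"
    using assms by (intro ip_kron) auto
  also have "\<dots> = (\<Sum>j<n. \<Sum>r<m. (if r = i then 1 else 0) * (\<Sum>j'<n. \<Sum>c<m.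
      (if c = i then 1 else 0) * (A $$ (j, j') * u $ (j * m + r) * v $ (j' * m + c))))"
    unfolding sum_distrib_left
    by (intro sum.cong refl) (simp only: index_diag_unit lessThan_iff mult.assoc mult.commute mult.left_commute)
  also have "\<dots> = (\<Sum>j<n. \<Sum>j'<n. A $$ (j, j') * u $ (j * m + i) * v $ (j' * m + i))"
    by (simp only: sum_select[OF assms(4)])
  also have "\<dots> = ip A (vec n (\<lambda>j. u $ (j * m + i))) (vec n (\<lambda>j. v $ (j * m + i)))"
    using assms(1) by (simp add: ip_sum[of _ n])
  finally show ?thesis .
qed

lemma ip_kron_diag_unit_left:
  assumes "B \<in> carrier_mat m m" "u \<in> carrier_vec (n * m)" "v \<in> carrier_vec (n * m)" "j < n"
  shows "ip (kron (diag_unit n j) B) u v =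
    ip B (vec m (\<lambda>i. u $ (j * m + i))) (vec m (\<lambda>i. v $ (j * m + i)))"
proof -
  have "ip (kron (diag_unit n j) B) u v = (\<Sum>r<n. \<Sum>i<m. \<Sum>c<n. \<Sum>i'<m.
     diag_unit n j $$ (r, c) * B $$ (i, i') * u $ (r * m + i) * v $ (c * m + i'))"
    using assms by (intro ip_kron) auto
  also have "\<dots> = (\<Sum>r<n. (if r = j then 1 else 0) * (\<Sum>i<m. \<Sum>c<n. (if c = j then 1 else 0) *
      (\<Sum>i'<m. B $$ (i, i') * u $ (r * m + i) * v $ (c * m + i'))))"
    unfolding sum_distrib_left
    by (intro sum.cong refl) (simp only: index_diag_unit lessThan_iff mult.assoc mult.commute mult.left_commute)
  also have "\<dots> = (\<Sum>i<m. \<Sum>i'<m. B $$ (i, i') * u $ (j * m + i) * v $ (j * m + i'))"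
    by (simp only: sum_select[OF assms(4)])
  also have "\<dots> = ip B (vec m (\<lambda>i. u $ (j * m + i))) (vec m (\<lambda>i. v $ (j * m + i)))"
    using assms(1) by (simp add: ip_sum[of _ m])
  finally show ?thesis .
qed

text \<open>Since \<open>H\<close> is symmetric, \<open>(D u, v) = u\<^sup>T (H D)\<^sup>T v\<close>, and a bilinear form determines its matrix.
  Summation by parts thus becomes a condition on the symmetric part of \<open>H D\<close> alone.\<close>

lemma sbp_iff_mat:
  assumes H: "H \<in> carrier_mat n n" "transpose_mat H = H" and D: "D \<in> carrier_mat n n"
    and C: "C \<in> carrier_mat n n"
  shows "(\<forall>u \<in> carrier_vec n. \<forall>v \<in> carrier_vec n.
      ip H u (D *\<^sub>v v) = ip C u v - ip H (D *\<^sub>v u) v) \<longleftrightarrow>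
    H * D + transpose_mat (H * D) = C"
proof -
  have T: "transpose_mat (H * D) = transpose_mat D * H"
    using H D by (simp add: transpose_mult[of _ n n _ n])
  have HD: "H * D + transpose_mat (H * D) \<in> carrier_mat n n" using H D by simp
  have eq: "ip H u (D *\<^sub>v v) + ip H (D *\<^sub>v u) v = ip (H * D + transpose_mat (H * D)) u v"
    if uv: "u \<in> carrier_vec n" "v \<in> carrier_vec n" for u v
    unfolding ip_mult_right[OF H(1) D uv(2)] ip_mult_left[OF D H(1) uv] T
    using H D uv by (intro ip_add_mat[symmetric, of _ n]) auto
  show ?thesis
  proof
    assume "\<forall>u \<in> carrier_vec n. \<forall>v \<in> carrier_vec n.
      ip H u (D *\<^sub>v v) = ip C u v - ip H (D *\<^sub>v u) v"
    then show "H * D + transpose_mat (H * D) = C"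
      using eq by (intro ip_determines_mat[OF HD C]) force
  next
    assume "H * D + transpose_mat (H * D) = C"
    then show "\<forall>u \<in> carrier_vec n. \<forall>v \<in> carrier_vec n.
      ip H u (D *\<^sub>v v) = ip C u v - ip H (D *\<^sub>v u) v"
      using eq by force
  qed
qed

lemma sbp_1d_mat:
  assumes "spd (M + 1) H" "sbp_1d M H D"
  shows "H * D + transpose_mat (H * D) = diag_unit (M + 1) M - diag_unit (M + 1) 0"
proof -
  have H: "H \<in> carrier_mat (M + 1) (M + 1)" "transpose_mat H = H"
    and D: "D \<in> carrier_mat (M + 1) (M + 1)" using assms by (auto simp: spd_def sbp_1d_def)
  have C: "diag_unit (M + 1) M - diag_unit (M + 1) 0 \<in> carrier_mat (M + 1) (M + 1)"
    by (intro minus_carrier_mat) simp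
  have ip_C: "ip (diag_unit (M + 1) M - diag_unit (M + 1) 0) a b = a $ M * b $ M - a $ 0 * b $ 0"
    if "a \<in> carrier_vec (M + 1)" "b \<in> carrier_vec (M + 1)" for a b
    using that by (subst ip_diff_mat[of _ "M + 1"]) (auto simp: ip_diag_unit)
  show ?thesis
    unfolding sbp_iff_mat[OF H D C, symmetric] using assms(2) ip_C by (simp add: sbp_1d_def)
qed

section \<open>Stacked and block-diagonal matrices\<close>

lemma diag_two_blocks:
  "diag_block_mat [A, B] =
    four_block_mat A (0\<^sub>m (dim_row A) (dim_col B)) (0\<^sub>m (dim_row B) (dim_col A)) B"
  by (simp only: diag_block_mat.simps(2)[of A "[B]"] diag_block_mat_singleton Let_def)

lemma diag_two_blocks_carrier:
  assumes "A \<in> carrier_mat m m" "B \<in> carrier_mat n n"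
  shows "diag_block_mat [A, B] \<in> carrier_mat (m + n) (m + n)"
  unfolding diag_two_blocks using assms by auto

lemma diag_two_blocks_mult:
  assumes "A \<in> carrier_mat m m" "B \<in> carrier_mat n n" "C \<in> carrier_mat m m" "D \<in> carrier_mat n n"
  shows "diag_block_mat [A, B] * diag_block_mat [C, D] = diag_block_mat [A * C, B * D]"
  unfolding diag_two_blocks
  using assms by (subst mult_four_block_mat[of _ m m _ n _ n]) auto

lemma diag_two_blocks_mult_vec:
  assumes "A \<in> carrier_mat m m" "B \<in> carrier_mat n n" "u \<in> carrier_vec m" "v \<in> carrier_vec n"
  shows "diag_block_mat [A, B] *\<^sub>v (u @\<^sub>v v) = (A *\<^sub>v u) @\<^sub>v (B *\<^sub>v v)"
  unfolding diag_two_blocks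
  using assms by (subst four_block_mat_mult_vec[of _ m m _ n _ n]) auto

lemma append_vec_minus:
  assumes "u \<in> carrier_vec m" "v \<in> carrier_vec n" "u' \<in> carrier_vec m" "v' \<in> carrier_vec n"
  shows "(u @\<^sub>v v) - (u' @\<^sub>v v') = (u - u') @\<^sub>v (v - v')"
  using assms by (intro eq_vecI) auto

lemma ip_diag_two_blocks:
  assumes "A \<in> carrier_mat m m" "B \<in> carrier_mat n n" "u \<in> carrier_vec m" "v \<in> carrier_vec n"
    "u' \<in> carrier_vec m" "v' \<in> carrier_vec n"
  shows "ip (diag_block_mat [A, B]) (u @\<^sub>v v) (u' @\<^sub>v v') = ip A u u' + ip B v v'"
  unfolding ip_def diag_two_blocks_mult_vec[OF assms(1,2,5,6)]
  using assms by (intro scalar_prod_append[of _ m _ n]) auto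

text \<open>Gluing at the level of bilinear forms: pulling a block-diagonal form back along the stacked
  extraction map adds the pulled-back forms of the blocks.\<close>

lemma congruence_append_rows:
  fixes A B F G :: "real mat"
  assumes F: "F \<in> carrier_mat m d" and G: "G \<in> carrier_mat n d"
    and A: "A \<in> carrier_mat m m" and B: "B \<in> carrier_mat n n"
  shows "transpose_mat (append_rows F G) * diag_block_mat [A, B] * append_rows F G
    = transpose_mat F * A * F + transpose_mat G * B * G"
proof (rule ip_determines_mat)
  note E = carrier_append_rows[OF F G] and AB = diag_two_blocks_carrier[OF A B]
  show "transpose_mat (append_rows F G) * diag_block_mat [A, B] * append_rows F G
      \<in> carrier_mat d d"
    using mult_carrier_mat[OF mult_carrier_mat[OF transpose_carrier_mat[THEN iffD2, OF E] AB] E] .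
  show "transpose_mat F * A * F + transpose_mat G * B * G \<in> carrier_mat d d"
    using assms by auto
  fix u v :: "real vec" assume uv: "u \<in> carrier_vec d" "v \<in> carrier_vec d"
  have "ip (transpose_mat F * A * F + transpose_mat G * B * G) u v
      = ip (transpose_mat F * A * F) u v + ip (transpose_mat G * B * G) u v"
    using assms uv by (intro ip_add_mat) auto
  also have "\<dots> = ip A (F *\<^sub>v u) (F *\<^sub>v v) + ip B (G *\<^sub>v u) (G *\<^sub>v v)"
    using assms uv by (simp only: ip_congruence[OF F A uv] ip_congruence[OF G B uv])
  also have "\<dots> = ip (diag_block_mat [A, B]) (append_rows F G *\<^sub>v u) (append_rows F G *\<^sub>v v)"
    unfolding mat_mult_append[OF F G uv(1)] mat_mult_append[OF F G uv(2)]
    using assms uv by (intro ip_diag_two_blocks[symmetric]) auto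
  also have "\<dots> = ip (transpose_mat (append_rows F G) * diag_block_mat [A, B] * append_rows F G) u v"
    by (rule ip_congruence[OF E AB uv, symmetric])
  finally show "ip (transpose_mat (append_rows F G) * diag_block_mat [A, B] * append_rows F G) u v
    = ip (transpose_mat F * A * F + transpose_mat G * B * G) u v" by simp
qed

lemma spd_diag_two_blocks:
  assumes "spd m A" "spd n B"
  shows "spd (m + n) (diag_block_mat [A, B])"
proof -
  have A: "A \<in> carrier_mat m m" "transpose_mat A = A"
    and B: "B \<in> carrier_mat n n" "transpose_mat B = B" using assms by (auto simp: spd_def)
  have "ip (diag_block_mat [A, B]) v v > 0" if v: "v \<in> carrier_vec (m + n)" "v \<noteq> 0\<^sub>v (m + n)" for v
  proof -
    let ?x = "vec_first v m" and ?y = "vec_last v n"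
    have split: "v = ?x @\<^sub>v ?y" using v by simp
    have "?x \<noteq> 0\<^sub>v m \<or> ?y \<noteq> 0\<^sub>v n"
    proof (rule ccontr)
      assume "\<not> ?thesis"
      then have "v = 0\<^sub>v m @\<^sub>v 0\<^sub>v n" using split by simp
      then show False using v by auto
    qed
    moreover have "ip A ?x ?x \<ge> 0" "ip B ?y ?y \<ge> 0"
      by (auto intro: spd_ip_nonneg[OF assms(1)] spd_ip_nonneg[OF assms(2)])
    moreover have "?x \<noteq> 0\<^sub>v m \<Longrightarrow> ip A ?x ?x > 0" "?y \<noteq> 0\<^sub>v n \<Longrightarrow> ip B ?y ?y > 0"
      using assms by (auto simp: spd_def ip_def)
    ultimately have "ip A ?x ?x + ip B ?y ?y > 0" by auto
    also have "ip A ?x ?x + ip B ?y ?y = ip (diag_block_mat [A, B]) (?x @\<^sub>v ?y) (?x @\<^sub>v ?y)"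
      using A B by (intro ip_diag_two_blocks[symmetric]) auto
    finally show ?thesis using split by simp
  qed
  moreover have "transpose_mat (diag_block_mat [A, B]) = diag_block_mat [A, B]"
    unfolding diag_two_blocks using A B by (subst transpose_four_block_mat) auto
  ultimately show ?thesis using diag_two_blocks_carrier[OF A(1) B(1)]
    by (simp add: spd_def ip_def)
qed

section \<open>The two-block grid\<close>

context
  fixes g :: two_block
  assumes g: "sbp_blocks g"
begin

lemma N_pos: "Nx g 1 \<ge> 1" "Nx g 2 \<ge> 1"
  using g by (auto simp: sbp_blocks_def)

lemma Hx_spd: "k \<in> {1, 2} \<Longrightarrow> spd (Nx g k + 1) (Hx g k)"
  and Hy_spd: "k \<in> {1, 2} \<Longrightarrow> spd (Ny g + 1) (Hy g k)"
  using g by (auto simp: sbp_blocks_def)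

lemma Dx1_sbp: "k \<in> {1, 2} \<Longrightarrow> sbp_1d (Nx g k) (Hx g k) (Dx1 g k)"
  and Dy1_sbp: "k \<in> {1, 2} \<Longrightarrow> sbp_1d (Ny g) (Hy g k) (Dy1 g k)"
  using g by (auto simp: sbp_blocks_def)

lemma op_carriers:
  assumes "k \<in> {1, 2}"
  shows "Hx g k \<in> carrier_mat (Nx g k + 1) (Nx g k + 1)"
    "Hy g k \<in> carrier_mat (Ny g + 1) (Ny g + 1)"
    "Dx1 g k \<in> carrier_mat (Nx g k + 1) (Nx g k + 1)"
    "Dy1 g k \<in> carrier_mat (Ny g + 1) (Ny g + 1)"
  using Hx_spd[OF assms] Hy_spd[OF assms] Dx1_sbp[OF assms] Dy1_sbp[OF assms]
  by (auto simp: spd_def sbp_1d_def)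

lemma E1_carrier: "E1 g k \<in> carrier_mat (Nx g k + 1) (Nxt g + 1)"
  by (simp add: E1_def)

private abbreviation dblk :: "nat \<Rightarrow> nat" where
  "dblk k \<equiv> (Ny g + 1) * (Nx g k + 1)"

lemma dimV_eq: "dimV g = (Ny g + 1) * (Nxt g + 1)"
  by (simp add: dimV_def)

lemma blk_carriers:
  assumes "k \<in> {1, 2}"
  shows "Hblk g k \<in> carrier_mat (dblk k) (dblk k)"
    "Dxblk g k \<in> carrier_mat (dblk k) (dblk k)"
    "Dyblk g k \<in> carrier_mat (dblk k) (dblk k)"
  unfolding Hblk_def Dxblk_def Dyblk_def
  by (intro kron_carrier op_carriers[OF assms] one_carrier_mat)+

lemma Eblk_carrier: "Eblk g k \<in> carrier_mat (dblk k) (dimV g)"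
  unfolding Eblk_def dimV_eq by (intro kron_carrier E1_carrier one_carrier_mat)

lemma Emat_carrier: "Emat g \<in> carrier_mat (dblk 1 + dblk 2) (dimV g)"
  unfolding Emat_def by (intro carrier_append_rows Eblk_carrier)

lemma offset_less:
  assumes "k \<in> {1, 2}" "i < Nx g k + 1"
  shows "offset g k + i < Nxt g + 1"
  using assms by (auto simp: offset_def Nxt_def)

lemma E1_mult_vec:
  assumes "k \<in> {1, 2}" "v \<in> carrier_vec (Nxt g + 1)" "i < Nx g k + 1"
  shows "(E1 g k *\<^sub>v v) $ i = v $ (offset g k + i)"
proof -
  have "(E1 g k *\<^sub>v v) $ i = (\<Sum>c<Nxt g + 1. (if c = offset g k + i then 1 else 0) * v $ c)"
    using assms by (auto simp: E1_def scalar_prod_def lessThan_atLeast0 intro!: sum.cong)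
  then show ?thesis using sum_select[OF offset_less[OF assms(1,3)]] by simp
qed

text \<open>The Kronecker product with the identity leaves the row index \<open>j\<close> alone, so a block vector is read
  off row by row from the global one, shifted by the block offset.\<close>

lemma Eblk_mult_vec:
  assumes k: "k \<in> {1, 2}" and v: "v \<in> carrier_vec (dimV g)" and j: "j < Ny g + 1"
    and i: "i < Nx g k + 1"
  shows "(Eblk g k *\<^sub>v v) $ (j * (Nx g k + 1) + i) = v $ (j * (Nxt g + 1) + (offset g k + i))"
proof -
  have "(Eblk g k *\<^sub>v v) $ (j * (Nx g k + 1) + i) =
      (\<Sum>c<(Ny g + 1) * (Nxt g + 1). Eblk g k $$ (j * (Nx g k + 1) + i, c) * v $ c)"
    using block_index_less[OF j i] Eblk_carrier[of k] v
    by (simp add: scalar_prod_def lessThan_atLeast0 dimV_eq)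
  also have "\<dots> = (\<Sum>j'<Ny g + 1. \<Sum>c<Nxt g + 1. (if j' = j then 1 else 0) *
      ((if c = offset g k + i then 1 else 0) * v $ (j' * (Nxt g + 1) + c)))"
    unfolding sum_lessThan_mult
  proof (intro sum.cong refl)
    fix j' c assume "j' \<in> {..<Ny g + 1}" "c \<in> {..<Nxt g + 1}"
    then have j': "j' < Ny g + 1" and c: "c < Nxt g + 1" by auto
    have "Eblk g k $$ (j * (Nx g k + 1) + i, j' * (Nxt g + 1) + c)
        = 1\<^sub>m (Ny g + 1) $$ (j, j') * E1 g k $$ (i, c)"
      unfolding Eblk_def by (rule index_kron_block[OF one_carrier_mat E1_carrier j i j' c])
    then show "Eblk g k $$ (j * (Nx g k + 1) + i, j' * (Nxt g + 1) + c) * v $ (j' * (Nxt g + 1) + c)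
      = (if j' = j then 1 else 0) *
        ((if c = offset g k + i then 1 else 0) * v $ (j' * (Nxt g + 1) + c))"
      using j j' i c by (auto simp: E1_def)
  qed
  also have "\<dots> = v $ (j * (Nxt g + 1) + (offset g k + i))"
    by (simp only: sum_distrib_left[symmetric] sum_select[OF j] sum_select[OF offset_less[OF k i]])
  finally show ?thesis .
qed

text \<open>Every global grid column lies in at least one of the blocks.\<close>

lemma Emat_injective:
  assumes v: "v \<in> carrier_vec (dimV g)" and 0: "Emat g *\<^sub>v v = 0\<^sub>v (dblk 1 + dblk 2)"
  shows "v = 0\<^sub>v (dimV g)"
proof (rule eq_vecI)
  have "(Eblk g 1 *\<^sub>v v) @\<^sub>v (Eblk g 2 *\<^sub>v v) = 0\<^sub>v (dblk 1) @\<^sub>v 0\<^sub>v (dblk 2)"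
    using 0 unfolding Emat_def mat_mult_append[OF Eblk_carrier Eblk_carrier v] by auto
  then have "Eblk g 1 *\<^sub>v v = 0\<^sub>v (dblk 1) \<and> Eblk g 2 *\<^sub>v v = 0\<^sub>v (dblk 2)"
    using Eblk_carrier[of 1] v by (subst (asm) append_vec_eq[of _ "dblk 1"]) auto
  then have E0: "Eblk g k *\<^sub>v v = 0\<^sub>v (dblk k)" if "k \<in> {1, 2}" for k using that by auto
  fix r assume "r < dim_vec (0\<^sub>v (dimV g))"
  then have r: "r < (Ny g + 1) * (Nxt g + 1)" by (simp add: dimV_eq)
  define j i where "j = r div (Nxt g + 1)" and "i = r mod (Nxt g + 1)"
  have j: "j < Ny g + 1" and i: "i < Nxt g + 1" and r_eq: "r = j * (Nxt g + 1) + i"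
    using div_mod_less[OF r] by (simp_all only: j_def i_def div_mult_mod_eq)
  have "\<exists>k \<in> {1, 2}. \<exists>i' < Nx g k + 1. i = offset g k + i'"
  proof (cases "i \<le> Nx g 1")
    case True
    then show ?thesis by (intro bexI[of _ 1] exI[of _ i]) (auto simp: offset_def)
  next
    case False
    then show ?thesis using i
      by (intro bexI[of _ 2] exI[of _ "i - Nx g 1"]) (auto simp: offset_def Nxt_def)
  qed
  then obtain k i' where k: "k \<in> {1, 2}" and i': "i' < Nx g k + 1" "i = offset g k + i'"
    by blast
  show "v $ r = 0\<^sub>v (dimV g) $ r"
    using Eblk_mult_vec[OF k v j i'(1)] E0[OF k] block_index_less[OF j i'(1)] r
    unfolding r_eq i'(2) by (simp add: dimV_eq)
qed (use v in simp)

lemma Hblk_spd: "k \<in> {1, 2} \<Longrightarrow> spd (dblk k) (Hblk g k)"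
  unfolding Hblk_def by (intro spd_kron Hy_spd Hx_spd)

lemma Hplus_spd: "spd (dblk 1 + dblk 2) (Hplus g)"
  unfolding Hplus_def by (intro spd_diag_two_blocks Hblk_spd) auto

lemma Hmat_spd: "spd (dimV g) (Hmat g)"
  unfolding Hmat_def by (intro spd_congruence[OF Hplus_spd Emat_carrier] Emat_injective)

subsection \<open>The glued operators and the pseudoinverse\<close>

private abbreviation Xg :: "real mat" where "Xg \<equiv> weighted_left_inverse (Hplus g) (Emat g)"

private lemmas gluing = Hplus_spd Emat_carrier Hmat_spd[unfolded Hmat_def]

private lemmas X_carrier = weighted_left_inverse_carrier[OF gluing]
private lemmas X_normal_eq = weighted_left_inverse_normal_eq[OF gluing, folded Hmat_def]
private lemmas X_mult_Emat = weighted_left_inverse_mult[OF gluing]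
private lemmas X_contraction = weighted_left_inverse_contraction[OF gluing, folded Hmat_def]

lemma Expinv_eq: "Expinv g = Xg"
  unfolding Expinv_def Hmat_def by (rule mp_inverse_eq_weighted_left_inverse[OF gluing])

lemma Dx_eq: "Dx g = Xg * Dxplus g * Emat g"
  and Dy_eq: "Dy g = Xg * Dyplus g * Emat g"
  by (simp_all only: Dx_def Dy_def weighted_left_inverse_def Hmat_def)

lemma glued_operator_carrier:
  assumes "P \<in> carrier_mat (dblk 1) (dblk 1)" "Q \<in> carrier_mat (dblk 2) (dblk 2)"
  shows "Xg * diag_block_mat [P, Q] * Emat g \<in> carrier_mat (dimV g) (dimV g)"
  using mult_carrier_mat[OF mult_carrier_mat[OF X_carrier diag_two_blocks_carrier[OF assms]] Emat_carrier] .

lemma Dx_carrier: "Dx g \<in> carrier_mat (dimV g) (dimV g)"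
  and Dy_carrier: "Dy g \<in> carrier_mat (dimV g) (dimV g)"
  unfolding Dx_eq Dy_eq Dxplus_def Dyplus_def
  by (intro glued_operator_carrier blk_carriers; simp)+

text \<open>The normal equation \<open>H Xg = E\<^sup>T H\<^sub>+\<close> removes the inverse of \<open>H\<close>, so the bilinear form of a glued
  operator is the sum of the forms of the block operators.\<close>

lemma Hmat_mult_glued_operator:
  assumes P: "P \<in> carrier_mat (dblk 1) (dblk 1)" and Q: "Q \<in> carrier_mat (dblk 2) (dblk 2)"
  shows "Hmat g * (Xg * diag_block_mat [P, Q] * Emat g) =
    transpose_mat (Eblk g 1) * (Hblk g 1 * P) * Eblk g 1
    + transpose_mat (Eblk g 2) * (Hblk g 2 * Q) * Eblk g 2"
proof -
  let ?n = "dblk 1 + dblk 2" and ?E = "Emat g" and ?D = "diag_block_mat [P, Q]"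
  note c = X_carrier Emat_carrier diag_two_blocks_carrier[OF P Q]
  have H: "Hmat g \<in> carrier_mat (dimV g) (dimV g)" and Hp: "Hplus g \<in> carrier_mat ?n ?n"
    using Hmat_spd Hplus_spd by (auto simp: spd_def)
  have Et: "transpose_mat ?E \<in> carrier_mat (dimV g) ?n" using Emat_carrier by simp
  have DE: "?D * ?E \<in> carrier_mat ?n (dimV g)" using c by (intro mult_carrier_mat)
  have "Hmat g * (Xg * ?D * ?E) = Hmat g * (Xg * (?D * ?E))"
    by (simp only: assoc_mult_mat[OF c(1,3,2)])
  also have "\<dots> = Hmat g * Xg * (?D * ?E)"
    by (rule assoc_mult_mat[OF H c(1) DE, symmetric])
  also have "\<dots> = transpose_mat ?E * (Hplus g * (?D * ?E))"
    unfolding X_normal_eq by (rule assoc_mult_mat[OF Et Hp DE])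
  also have "\<dots> = transpose_mat ?E * (Hplus g * ?D) * ?E"
    using assoc_mult_mat[OF Hp c(3,2)]
      assoc_mult_mat[OF Et mult_carrier_mat[OF Hp c(3)] c(2)] by simp
  also have "Hplus g * ?D = diag_block_mat [Hblk g 1 * P, Hblk g 2 * Q]"
    unfolding Hplus_def by (rule diag_two_blocks_mult[OF blk_carriers(1) blk_carriers(1) P Q]) auto
  also have "transpose_mat ?E * \<dots> * ?E =
      transpose_mat (Eblk g 1) * (Hblk g 1 * P) * Eblk g 1
      + transpose_mat (Eblk g 2) * (Hblk g 2 * Q) * Eblk g 2"
    unfolding Emat_def
    by (rule congruence_append_rows[OF Eblk_carrier Eblk_carrier
         mult_carrier_mat[OF blk_carriers(1) P] mult_carrier_mat[OF blk_carriers(1) Q]]) auto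
  finally show ?thesis .
qed

lemma Eblk_congruence_kron:
  assumes A: "A \<in> carrier_mat (Ny g + 1) (Ny g + 1)"
    and B: "B \<in> carrier_mat (Nx g k + 1) (Nx g k + 1)"
  shows "transpose_mat (Eblk g k) * kron A B * Eblk g k
    = kron A (transpose_mat (E1 g k) * B * E1 g k)"
proof -
  have E1t: "transpose_mat (E1 g k) \<in> carrier_mat (Nxt g + 1) (Nx g k + 1)"
    using E1_carrier by simp
  show ?thesis
    unfolding Eblk_def transpose_kron transpose_one
      kron_mult[OF one_carrier_mat E1t A B] left_mult_one_mat[OF A]
      kron_mult[OF A mult_carrier_mat[OF E1t B] one_carrier_mat E1_carrier] right_mult_one_mat[OF A] ..
qed

subsection \<open>Summation by parts\<close>

text \<open>The one-dimensional matrices \<open>H\<^sub>1\<^sup>(\<^sup>k\<^sup>)\<close> and \<open>H\<^sub>1\<^sup>(\<^sup>k\<^sup>) D\<^sub>1\<^sup>(\<^sup>k\<^sup>)\<close> of block \<open>k\<close>, extended by zero to the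
  full grid line in the \<open>x\<close>-direction.\<close>

definition Hx_ext :: "nat \<Rightarrow> real mat" where
  "Hx_ext k = transpose_mat (E1 g k) * Hx g k * E1 g k"

definition Qx_ext :: "nat \<Rightarrow> real mat" where
  "Qx_ext k = transpose_mat (E1 g k) * (Hx g k * Dx1 g k) * E1 g k"

lemma ext_carrier:
  assumes "k \<in> {1, 2}"
  shows "Hx_ext k \<in> carrier_mat (Nxt g + 1) (Nxt g + 1)"
    "Qx_ext k \<in> carrier_mat (Nxt g + 1) (Nxt g + 1)"
  unfolding Hx_ext_def Qx_ext_def
  by (rule congruence_carrier[OF E1_carrier op_carriers(1)[OF assms]])
     (rule congruence_carrier[OF E1_carrier mult_carrier_mat[OF op_carriers(1,3)[OF assms]]])

lemma Hmat_mult_Dx: "Hmat g * Dx g = kron (Hy g 1) (Qx_ext 1) + kron (Hy g 2) (Qx_ext 2)"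
proof -
  have "transpose_mat (Eblk g k) * (Hblk g k * Dxblk g k) * Eblk g k = kron (Hy g k) (Qx_ext k)"
    if k: "k \<in> {1, 2}" for k
    unfolding Hblk_def Dxblk_def Qx_ext_def
      kron_mult[OF op_carriers(2,1)[OF k] one_carrier_mat op_carriers(3)[OF k]]
      right_mult_one_mat[OF op_carriers(2)[OF k]]
    by (rule Eblk_congruence_kron[OF op_carriers(2)[OF k] mult_carrier_mat[OF op_carriers(1,3)[OF k]]])
  then show ?thesis
    unfolding Dx_eq Dxplus_def
    using Hmat_mult_glued_operator[OF blk_carriers(2) blk_carriers(2)] by simp
qed

lemma Hmat_mult_Dy:
  "Hmat g * Dy g = kron (Hy g 1 * Dy1 g 1) (Hx_ext 1) + kron (Hy g 2 * Dy1 g 2) (Hx_ext 2)"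
proof -
  have "transpose_mat (Eblk g k) * (Hblk g k * Dyblk g k) * Eblk g k
      = kron (Hy g k * Dy1 g k) (Hx_ext k)"
    if k: "k \<in> {1, 2}" for k
    unfolding Hblk_def Dyblk_def Hx_ext_def
      kron_mult[OF op_carriers(2,1)[OF k] op_carriers(4)[OF k] one_carrier_mat]
      right_mult_one_mat[OF op_carriers(1)[OF k]]
    by (rule Eblk_congruence_kron[OF mult_carrier_mat[OF op_carriers(2,4)[OF k]] op_carriers(1)[OF k]])
  then show ?thesis
    unfolding Dy_eq Dyplus_def
    using Hmat_mult_glued_operator[OF blk_carriers(3) blk_carriers(3)] by simp
qed

text \<open>The boundary form of block \<open>k\<close> sits at its first and last column, which are the columns
  \<open>offset g k\<close> and \<open>offset g k + Nx g k\<close> of the global grid.\<close>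

lemma Qx_ext_sbp:
  assumes k: "k \<in> {1, 2}"
  shows "Qx_ext k + transpose_mat (Qx_ext k)
    = diag_unit (Nxt g + 1) (offset g k + Nx g k) - diag_unit (Nxt g + 1) (offset g k)"
proof -
  let ?B = "diag_unit (Nx g k + 1) (Nx g k) - diag_unit (Nx g k + 1) 0"
  have B: "?B \<in> carrier_mat (Nx g k + 1) (Nx g k + 1)" by (intro minus_carrier_mat) simp
  have "Qx_ext k + transpose_mat (Qx_ext k) = transpose_mat (E1 g k) * ?B * E1 g k"
    unfolding Qx_ext_def sbp_1d_mat[OF Hx_spd[OF k] Dx1_sbp[OF k], symmetric]
    by (rule congruence_add_transpose[OF E1_carrier mult_carrier_mat[OF op_carriers(1,3)[OF k]]])
  also have "\<dots> = diag_unit (Nxt g + 1) (offset g k + Nx g k) - diag_unit (Nxt g + 1) (offset g k)"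
  proof (rule ip_determines_mat)
    fix u v :: "real vec" assume uv: "u \<in> carrier_vec (Nxt g + 1)" "v \<in> carrier_vec (Nxt g + 1)"
    have Euv: "E1 g k *\<^sub>v u \<in> carrier_vec (Nx g k + 1)" "E1 g k *\<^sub>v v \<in> carrier_vec (Nx g k + 1)"
      by (intro mult_mat_vec_carrier[OF E1_carrier] uv)+
    have "ip (transpose_mat (E1 g k) * ?B * E1 g k) u v = ip ?B (E1 g k *\<^sub>v u) (E1 g k *\<^sub>v v)"
      by (rule ip_congruence[OF E1_carrier B uv])
    also have "\<dots> = u $ (offset g k + Nx g k) * v $ (offset g k + Nx g k)
        - u $ offset g k * v $ offset g k"
      using Euv E1_mult_vec[OF k uv(1)] E1_mult_vec[OF k uv(2)]
      by (simp add: ip_diff_mat[of _ "Nx g k + 1"] ip_diag_unit)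
    also have "\<dots> = ip (diag_unit (Nxt g + 1) (offset g k + Nx g k) - diag_unit (Nxt g + 1) (offset g k)) u v"
      using uv offset_less[OF k, of "Nx g k"] offset_less[OF k, of 0]
      by (simp add: ip_diff_mat[of _ "Nxt g + 1"] ip_diag_unit)
    finally show "ip (transpose_mat (E1 g k) * ?B * E1 g k) u v =
      ip (diag_unit (Nxt g + 1) (offset g k + Nx g k) - diag_unit (Nxt g + 1) (offset g k)) u v" .
  qed (intro congruence_carrier[OF E1_carrier B] minus_carrier_mat diag_unit_carrier)+
  finally show ?thesis .
qed

text \<open>Both blocks contribute at the interface column \<open>Nx g 1\<close>, with opposite signs but with their own
  weights in the \<open>y\<close>-direction.\<close>

lemma symmetric_part_Dx:
  "Hmat g * Dx g + transpose_mat (Hmat g * Dx g) =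
     kron (Hy g 1) (diag_unit (Nxt g + 1) (Nx g 1) - diag_unit (Nxt g + 1) 0)
     + kron (Hy g 2) (diag_unit (Nxt g + 1) (Nxt g) - diag_unit (Nxt g + 1) (Nx g 1))"
proof -
  have "kron (Hy g k) (Qx_ext k) + transpose_mat (kron (Hy g k) (Qx_ext k))
      = kron (Hy g k) (diag_unit (Nxt g + 1) (offset g k + Nx g k) - diag_unit (Nxt g + 1) (offset g k))"
    if k: "k \<in> {1, 2}" for k
  proof -
    have "transpose_mat (Hy g k) = Hy g k" using Hy_spd[OF k] by (simp add: spd_def)
    moreover have "transpose_mat (Qx_ext k) \<in> carrier_mat (Nxt g + 1) (Nxt g + 1)"
      using ext_carrier(2)[OF k] by simp
    ultimately show ?thesis
      unfolding transpose_kron Qx_ext_sbp[OF k, symmetric]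
      using kron_add_right[OF op_carriers(2)[OF k] ext_carrier(2)[OF k]] by simp
  qed
  from this[of 1] this[of 2] show ?thesis
    unfolding Hmat_mult_Dx
    by (subst add_transpose_sum[OF kron_carrier[OF op_carriers(2) ext_carrier(2)]
          kron_carrier[OF op_carriers(2) ext_carrier(2)]])
       (auto simp: offset_def Nxt_def)
qed

text \<open>Summation by parts in \<open>y\<close> produces the same boundary matrix in both blocks whatever their
  \<open>y\<close>-weights, so the \<open>x\<close>-weights simply add up to \<open>H1mat\<close>.\<close>

lemma symmetric_part_Dy:
  "Hmat g * Dy g + transpose_mat (Hmat g * Dy g) =
     kron (diag_unit (Ny g + 1) (Ny g) - diag_unit (Ny g + 1) 0) (H1mat g)"
proof -
  let ?B = "diag_unit (Ny g + 1) (Ny g) - diag_unit (Ny g + 1) 0"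
  have B: "?B \<in> carrier_mat (Ny g + 1) (Ny g + 1)" by (intro minus_carrier_mat) simp
  have "kron (Hy g k * Dy1 g k) (Hx_ext k) + transpose_mat (kron (Hy g k * Dy1 g k) (Hx_ext k))
      = kron ?B (Hx_ext k)"
    if k: "k \<in> {1, 2}" for k
  proof -
    have HD: "Hy g k * Dy1 g k \<in> carrier_mat (Ny g + 1) (Ny g + 1)"
      by (rule mult_carrier_mat[OF op_carriers(2,4)[OF k]])
    have sym: "transpose_mat (Hx_ext k) = Hx_ext k"
      using transpose_congruence[OF E1_carrier op_carriers(1)[OF k]] Hx_spd[OF k]
      by (simp add: Hx_ext_def spd_def)
    have "transpose_mat (Hy g k * Dy1 g k) \<in> carrier_mat (Ny g + 1) (Ny g + 1)"
      using HD by simp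
    from kron_add_left[OF HD this ext_carrier(1)[OF k]] show ?thesis
      unfolding transpose_kron sym sbp_1d_mat[OF Hy_spd[OF k] Dy1_sbp[OF k]] by simp
  qed
  from this[of 1] this[of 2] 
  have "Hmat g * Dy g + transpose_mat (Hmat g * Dy g) = kron ?B (Hx_ext 1) + kron ?B (Hx_ext 2)"
    unfolding Hmat_mult_Dy
    by (subst add_transpose_sum[OF kron_carrier[OF mult_carrier_mat[OF op_carriers(2,4)] ext_carrier(1)]
          kron_carrier[OF mult_carrier_mat[OF op_carriers(2,4)] ext_carrier(1)]])
       auto
  also have "\<dots> = kron ?B (Hx_ext 1 + Hx_ext 2)"
    by (rule kron_add_right[OF B ext_carrier(1) ext_carrier(1), symmetric]) auto
  also have "Hx_ext 1 + Hx_ext 2 = H1mat g" by (simp add: Hx_ext_def H1mat_def)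
  finally show ?thesis .
qed

lemma H1mat_carrier: "H1mat g \<in> carrier_mat (Nxt g + 1) (Nxt g + 1)"
  unfolding H1mat_def using ext_carrier(1)[of 1] ext_carrier(1)[of 2]
  by (simp add: Hx_ext_def)

lemma bp_x:
  assumes H2: "H2 \<in> carrier_mat (Ny g + 1) (Ny g + 1)"
    and uv: "u \<in> carrier_vec (dimV g)" "v \<in> carrier_vec (dimV g)"
  shows "bp2 g H2 u v - bp4 g H2 u v =
    ip (kron H2 (diag_unit (Nxt g + 1) (Nxt g) - diag_unit (Nxt g + 1) 0)) u v"
  using uv
    kron_carrier[OF H2 diag_unit_carrier[of "Nxt g + 1" "Nxt g"]]
    kron_carrier[OF H2 diag_unit_carrier[of "Nxt g + 1" 0]]
  unfolding bp2_def bp4_def col_at_def dimV_eq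
    kron_diff_right[OF H2 diag_unit_carrier[of "Nxt g + 1" "Nxt g"] diag_unit_carrier[of "Nxt g + 1" 0]]
  by (simp only: ip_diff_mat ip_kron_diag_unit_right[OF H2])

lemma bp_y:
  assumes uv: "u \<in> carrier_vec (dimV g)" "v \<in> carrier_vec (dimV g)"
  shows "bp3 g u v - bp1 g u v =
    ip (kron (diag_unit (Ny g + 1) (Ny g) - diag_unit (Ny g + 1) 0) (H1mat g)) u v"
  using uv
    kron_carrier[OF diag_unit_carrier[of "Ny g + 1" "Ny g"] H1mat_carrier]
    kron_carrier[OF diag_unit_carrier[of "Ny g + 1" 0] H1mat_carrier]
  unfolding bp3_def bp1_def row_at_def dimV_eq
    kron_diff_left[OF diag_unit_carrier[of "Ny g + 1" "Ny g"] diag_unit_carrier[of "Ny g + 1" 0] H1mat_carrier]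
  by (simp only: ip_diff_mat ip_kron_diag_unit_left[OF H1mat_carrier])


text \<open>The identity for \<open>D\<^sub>y\<close> always holds, so summation by parts is decided by the \<open>x\<close>-direction.\<close>

lemma sbp_2d_iff_mat:
  assumes H2: "H2 \<in> carrier_mat (Ny g + 1) (Ny g + 1)"
  shows "sbp_2d g H2 \<longleftrightarrow>
    Hmat g * Dx g + transpose_mat (Hmat g * Dx g)
      = kron H2 (diag_unit (Nxt g + 1) (Nxt g) - diag_unit (Nxt g + 1) 0)"
proof -
  let ?x = "kron H2 (diag_unit (Nxt g + 1) (Nxt g) - diag_unit (Nxt g + 1) 0)"
  let ?y = "kron (diag_unit (Ny g + 1) (Ny g) - diag_unit (Ny g + 1) 0) (H1mat g)"
  have H: "Hmat g \<in> carrier_mat (dimV g) (dimV g)" "transpose_mat (Hmat g) = Hmat g"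
    using Hmat_spd by (auto simp: spd_def)
  have x: "?x \<in> carrier_mat (dimV g) (dimV g)" and y: "?y \<in> carrier_mat (dimV g) (dimV g)"
    unfolding dimV_eq by (intro kron_carrier minus_carrier_mat diag_unit_carrier H2 H1mat_carrier)+
  have "sbp_2d g H2 \<longleftrightarrow>
    (\<forall>u \<in> carrier_vec (dimV g). \<forall>v \<in> carrier_vec (dimV g).
      ip (Hmat g) u (Dx g *\<^sub>v v) = ip ?x u v - ip (Hmat g) (Dx g *\<^sub>v u) v) \<and>
    (\<forall>u \<in> carrier_vec (dimV g). \<forall>v \<in> carrier_vec (dimV g).
      ip (Hmat g) u (Dy g *\<^sub>v v) = ip ?y u v - ip (Hmat g) (Dy g *\<^sub>v u) v)"
    unfolding sbp_2d_def using bp_x[OF H2] bp_y by auto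
  then show ?thesis
    unfolding sbp_iff_mat[OF H Dx_carrier x] sbp_iff_mat[OF H Dy_carrier y] using symmetric_part_Dy by simp
qed

text \<open>The boundary columns \<open>0\<close> and \<open>Nxt g\<close> each belong to only one block, so the diagonal entries there
  compare \<open>H2\<close> with the weight of that block. Conversely, equal weights cancel at the interface.\<close>

lemma sbp_2d_iff:
  assumes H2: "H2 \<in> carrier_mat (Ny g + 1) (Ny g + 1)"
  shows "sbp_2d g H2 \<longleftrightarrow> Hy g 1 = H2 \<and> Hy g 2 = H2"
proof -
  let ?m = "Nxt g + 1" and ?n = "Ny g + 1"
  let ?L = "diag_unit ?m (Nx g 1) - diag_unit ?m 0"
  let ?R = "diag_unit ?m (Nxt g) - diag_unit ?m (Nx g 1)"
  let ?T = "diag_unit ?m (Nxt g) - diag_unit ?m 0"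
  have c: "?L \<in> carrier_mat ?m ?m" "?R \<in> carrier_mat ?m ?m" "?T \<in> carrier_mat ?m ?m"
    by (intro minus_carrier_mat diag_unit_carrier)+
  have Hy: "Hy g 1 \<in> carrier_mat ?n ?n" "Hy g 2 \<in> carrier_mat ?n ?n"
    using op_carriers(2) by auto
  have "kron (Hy g 1) ?L + kron (Hy g 2) ?R = kron H2 ?T \<longleftrightarrow> Hy g 1 = H2 \<and> Hy g 2 = H2"
  proof
    assume eq: "kron (Hy g 1) ?L + kron (Hy g 2) ?R = kron H2 ?T"
    have entry: "Hy g 1 $$ (j, j') * ?L $$ (i, i) + Hy g 2 $$ (j, j') * ?R $$ (i, i)
        = H2 $$ (j, j') * ?T $$ (i, i)"
      if "j < ?n" "j' < ?n" "i < ?m" for i j j'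
    proof -
      have "(kron (Hy g 1) ?L + kron (Hy g 2) ?R) $$ (j * ?m + i, j' * ?m + i)
          = kron (Hy g 1) ?L $$ (j * ?m + i, j' * ?m + i)
            + kron (Hy g 2) ?R $$ (j * ?m + i, j' * ?m + i)"
        using kron_carrier[OF Hy(2) c(2)] block_index_less[OF that(1,3)] block_index_less[OF that(2,3)]
        by (intro index_add_mat) (simp_all only: carrier_matD)
      then show ?thesis
        unfolding eq index_kron_block[OF Hy(1) c(1) that(1,3,2,3)]
          index_kron_block[OF Hy(2) c(2) that(1,3,2,3)] index_kron_block[OF H2 c(3) that(1,3,2,3)]
        by simp
    qed
    \<comment> \<open>each block has at least one cell, so the columns \<open>0\<close>, \<open>Nx g 1\<close>, \<open>Nxt g\<close> are distinct\<close>
    have corner: "?L $$ (0, 0) = -1" "?R $$ (0, 0) = 0" "?T $$ (0, 0) = -1"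
      "?L $$ (Nxt g, Nxt g) = 0" "?R $$ (Nxt g, Nxt g) = 1" "?T $$ (Nxt g, Nxt g) = 1"
      using N_pos by (auto simp: diag_unit_def Nxt_def)
    have "Hy g 1 = H2"
    proof (rule eq_matI)
      fix j j' assume "j < dim_row H2" "j' < dim_col H2"
      then show "Hy g 1 $$ (j, j') = H2 $$ (j, j')"
        using entry[of j j' 0] H2 corner by simp
    qed (use Hy H2 in auto)
    moreover have "Hy g 2 = H2"
    proof (rule eq_matI)
      fix j j' assume "j < dim_row H2" "j' < dim_col H2"
      then show "Hy g 2 $$ (j, j') = H2 $$ (j, j')"
        using entry[of j j' "Nxt g"] H2 corner by simp
    qed (use Hy H2 in auto)
    ultimately show "Hy g 1 = H2 \<and> Hy g 2 = H2" ..
  next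
    assume eq: "Hy g 1 = H2 \<and> Hy g 2 = H2"
    have "?L + ?R = ?T" by (intro eq_matI) (auto simp: diag_unit_def)
    then show "kron (Hy g 1) ?L + kron (Hy g 2) ?R = kron H2 ?T"
      using kron_add_right[OF H2 c(1,2)] eq by simp
  qed
  then show ?thesis unfolding sbp_2d_iff_mat[OF H2] symmetric_part_Dx .
qed

subsection \<open>Consistency\<close>

lemma xglob_offset:
  assumes "k \<in> {1, 2}" "i < Nx g k + 1"
  shows "xglob g (offset g k + i) = xblk g k i"
proof (cases "k = 1")
  case True
  then show ?thesis using assms by (simp add: xglob_def offset_def)
next
  case False
  then have k: "k = 2" using assms by simp
  \<comment> \<open>the last column of block 1 and the first column of block 2 are both at \<open>x = 1/2\<close>\<close>
  have "xblk g 1 (Nx g 1) = xblk g 2 0" using N_pos(1) by (simp add: xblk_def hx_def)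
  then show ?thesis by (cases "i = 0") (auto simp: k xglob_def offset_def)
qed

lemma Eblk_restr:
  assumes k: "k \<in> {1, 2}"
  shows "Eblk g k *\<^sub>v restr g u = restr_blk g k u"
proof (rule eq_vecI)
  fix r assume "r < dim_vec (restr_blk g k u)"
  then have r: "r < (Ny g + 1) * (Nx g k + 1)" by (simp add: restr_blk_def mult.commute)
  define j i where "j = r div (Nx g k + 1)" and "i = r mod (Nx g k + 1)"
  have j: "j < Ny g + 1" and i: "i < Nx g k + 1" and r_eq: "r = j * (Nx g k + 1) + i"
    using div_mod_less[OF r] by (simp_all only: j_def i_def div_mult_mod_eq)
  let ?s = "j * (Nxt g + 1) + (offset g k + i)"
  note o = offset_less[OF k i]
  have s: "?s < dimV g" using block_index_less[OF j o] by (simp only: dimV_eq)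
  have "?s mod (Nxt g + 1) = offset g k + i" "?s div (Nxt g + 1) = j"
    by (rule block_index_div_mod[OF o])+
  then have "restr g u $ ?s = u (xglob g (offset g k + i), yglob g j)"
    unfolding restr_def index_vec[OF s] by (simp only:)
  moreover have "(Eblk g k *\<^sub>v restr g u) $ r = restr g u $ ?s"
    unfolding r_eq by (rule Eblk_mult_vec[OF k _ j i]) (simp add: restr_def)
  moreover have "restr_blk g k u $ r = u (xblk g k i, yglob g j)"
    using r by (simp add: restr_blk_def j_def i_def mult.commute)
  ultimately show "(Eblk g k *\<^sub>v restr g u) $ r = restr_blk g k u $ r"
    by (simp only: xglob_offset[OF k i])
next
  show "dim_vec (Eblk g k *\<^sub>v restr g u) = dim_vec (restr_blk g k u)"
    using Eblk_carrier[of k] by (simp add: restr_blk_def mult.commute)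
qed

lemma restr_blk_carrier: "restr_blk g k u \<in> carrier_vec (dblk k)"
  by (simp add: restr_blk_def mult.commute)

lemma Emat_restr: "Emat g *\<^sub>v restr g u = restr_blk g 1 u @\<^sub>v restr_blk g 2 u"
proof -
  have "restr g u \<in> carrier_vec (dimV g)" by (simp add: restr_def)
  then show ?thesis
    unfolding Emat_def by (subst mat_mult_append[OF Eblk_carrier Eblk_carrier]) (simp_all add: Eblk_restr)
qed

text \<open>As \<open>Xg E = 1\<close>, the error is \<open>Xg (D\<^sub>+ E u - E w)\<close>, and \<open>E u\<close>, \<open>E w\<close> are the pairs of block
  restrictions. Then \<open>Xg\<close> is a contraction, and \<open>H\<^sub>+\<close> adds the squared block norms.\<close>

lemma glued_truncation_error:
  assumes P: "P \<in> carrier_mat (dblk 1) (dblk 1)" and Q: "Q \<in> carrier_mat (dblk 2) (dblk 2)"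
  shows "ip_norm (Hmat g) ((Xg * diag_block_mat [P, Q] * Emat g) *\<^sub>v restr g u - restr g w)
    \<le> ip_norm (Hblk g 1) (P *\<^sub>v restr_blk g 1 u - restr_blk g 1 w)
      + ip_norm (Hblk g 2) (Q *\<^sub>v restr_blk g 2 u - restr_blk g 2 w)"
proof -
  let ?n = "dblk 1 + dblk 2" and ?D = "diag_block_mat [P, Q]"
  let ?e = "P *\<^sub>v restr_blk g 1 u - restr_blk g 1 w" and ?f = "Q *\<^sub>v restr_blk g 2 u - restr_blk g 2 w"
  have r: "restr g h \<in> carrier_vec (dimV g)" for h by (simp add: restr_def)
  note rb = restr_blk_carrier
  note c = X_carrier Emat_carrier diag_two_blocks_carrier[OF P Q]
  have e: "?e \<in> carrier_vec (dblk 1)" and f: "?f \<in> carrier_vec (dblk 2)"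
    using P Q rb by auto
  have Er: "Emat g *\<^sub>v restr g h \<in> carrier_vec ?n" for h
    by (rule mult_mat_vec_carrier[OF c(2) r])
  have "(Xg * ?D * Emat g) *\<^sub>v restr g u = Xg *\<^sub>v (?D *\<^sub>v (Emat g *\<^sub>v restr g u))"
    by (simp only: assoc_mult_mat_vec[OF mult_carrier_mat[OF c(1,3)] c(2) r]
        assoc_mult_mat_vec[OF c(1,3) Er])
  moreover have "restr g w = Xg *\<^sub>v (Emat g *\<^sub>v restr g w)"
    using assoc_mult_mat_vec[OF c(1,2) r] X_mult_Emat r by (metis one_mult_mat_vec)
  moreover have "Xg *\<^sub>v (?D *\<^sub>v (Emat g *\<^sub>v restr g u)) - Xg *\<^sub>v (Emat g *\<^sub>v restr g w)
      = Xg *\<^sub>v (?D *\<^sub>v (Emat g *\<^sub>v restr g u) - Emat g *\<^sub>v restr g w)"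
    by (rule mult_minus_distrib_mat_vec[OF c(1) mult_mat_vec_carrier[OF c(3) Er] Er, symmetric])
  moreover have "?D *\<^sub>v (Emat g *\<^sub>v restr g u) - Emat g *\<^sub>v restr g w = ?e @\<^sub>v ?f"
    unfolding Emat_restr diag_two_blocks_mult_vec[OF P Q rb rb]
    by (rule append_vec_minus[OF mult_mat_vec_carrier[OF P rb] mult_mat_vec_carrier[OF Q rb] rb rb])
  ultimately have err: "(Xg * ?D * Emat g) *\<^sub>v restr g u - restr g w = Xg *\<^sub>v (?e @\<^sub>v ?f)"
    by simp
  have ef: "?e @\<^sub>v ?f \<in> carrier_vec ?n" using e f by (rule append_carrier_vec)
  have "ip (Hmat g) (Xg *\<^sub>v (?e @\<^sub>v ?f)) (Xg *\<^sub>v (?e @\<^sub>v ?f)) \<le> ip (Hplus g) (?e @\<^sub>v ?f) (?e @\<^sub>v ?f)"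
    by (rule X_contraction[OF ef])
  also have "\<dots> = ip (Hblk g 1) ?e ?e + ip (Hblk g 2) ?f ?f"
    unfolding Hplus_def
    by (rule ip_diag_two_blocks[OF blk_carriers(1) blk_carriers(1) e f e f]) auto
  finally have "ip_norm (Hmat g) (Xg *\<^sub>v (?e @\<^sub>v ?f)) \<le> sqrt (ip (Hblk g 1) ?e ?e + ip (Hblk g 2) ?f ?f)"
    unfolding ip_norm_def by (rule real_sqrt_le_mono)
  also have "\<dots> \<le> ip_norm (Hblk g 1) ?e + ip_norm (Hblk g 2) ?f"
    unfolding ip_norm_def
    using spd_ip_nonneg[OF Hblk_spd e] spd_ip_nonneg[OF Hblk_spd f]
    by (intro sqrt_add_le_add_sqrt) auto
  finally show ?thesis by (simp only: err)
qed

lemma truncation_error_Dx: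
  "ip_norm (Hmat g) (Dx g *\<^sub>v restr g u - restr g w)
    \<le> ip_norm (Hblk g 1) (Dxblk g 1 *\<^sub>v restr_blk g 1 u - restr_blk g 1 w)
      + ip_norm (Hblk g 2) (Dxblk g 2 *\<^sub>v restr_blk g 2 u - restr_blk g 2 w)"
  unfolding Dx_eq Dxplus_def by (intro glued_truncation_error blk_carriers) auto

lemma truncation_error_Dy:
  "ip_norm (Hmat g) (Dy g *\<^sub>v restr g u - restr g w)
    \<le> ip_norm (Hblk g 1) (Dyblk g 1 *\<^sub>v restr_blk g 1 u - restr_blk g 1 w)
      + ip_norm (Hblk g 2) (Dyblk g 2 *\<^sub>v restr_blk g 2 u - restr_blk g 2 w)"
  unfolding Dy_eq Dyplus_def by (intro glued_truncation_error blk_carriers) auto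

lemma ip_norm_Hmat_nonneg:
  assumes "A \<in> carrier_mat (dimV g) (dimV g)"
  shows "ip_norm (Hmat g) (A *\<^sub>v restr g u - restr g w) \<ge> 0"
  unfolding ip_norm_def using assms
  by (intro real_sqrt_ge_zero spd_ip_nonneg[OF Hmat_spd]) (auto simp: restr_def)

end

lemma bigo_of_le_sum:
  fixes e f1 f2 b :: "'i \<Rightarrow> real"
  assumes "\<And>t. 0 \<le> e t" "\<And>t. e t \<le> f1 t + f2 t" "f1 \<in> O[F](b)" "f2 \<in> O[F](b)"
  shows "e \<in> O[F](b)"
proof -
  have "norm (e t) \<le> norm (f1 t + f2 t)" for t
    using assms(1)[of t] assms(2)[of t] by simp
  then have "e \<in> O[F](\<lambda>t. f1 t + f2 t)"
    by (intro landau_o.big_mono always_eventually) auto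
  also have "(\<lambda>t. f1 t + f2 t) \<in> O[F](b)" using assms(3,4) by (rule sum_in_bigo)
  finally show ?thesis .
qed

theorem proposition82:
  fixes g :: "'i \<Rightarrow> two_block" and H2 :: "'i \<Rightarrow> real mat" and p :: real
  assumes "\<And>t. sbp_blocks (g t)"
    and "p > 0" and "blocks_consistent g p"
    and "\<And>t. spd (Ny (g t) + 1) (H2 t)"
  shows "(\<forall>t. sbp_2d (g t) (H2 t) \<longleftrightarrow> Hy (g t) 1 = H2 t \<and> Hy (g t) 2 = H2 t)
       \<and> (consistent_x g p \<and> consistent_y g p)
       \<and> (\<forall>t. Dx (g t) = Expinv (g t) * Dxplus (g t) * Emat (g t)
             \<and> Dy (g t) = Expinv (g t) * Dyplus (g t) * Emat (g t))"
proof (intro conjI allI)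
  fix t
  show "sbp_2d (g t) (H2 t) \<longleftrightarrow> Hy (g t) 1 = H2 t \<and> Hy (g t) 2 = H2 t"
    using assms(4)[of t] by (intro sbp_2d_iff assms(1)) (simp add: spd_def)
  show "Dx (g t) = Expinv (g t) * Dxplus (g t) * Emat (g t)"
    "Dy (g t) = Expinv (g t) * Dyplus (g t) * Emat (g t)"
    by (simp_all only: Dx_eq[OF assms(1)] Dy_eq[OF assms(1)] Expinv_eq[OF assms(1)])
next
  show "consistent_x g p"
    unfolding consistent_x_def
  proof (intro allI impI)
    fix u assume "smooth_near (Omega 1 \<union> Omega 2) u"
    then show "(\<lambda>t. ip_norm (Hmat (g t)) (Dx (g t) *\<^sub>v restr (g t) u - restr (g t) (ddx u)))
          \<in> O[refine g](\<lambda>t. hmax (g t) powr p)"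
      using assms(3) unfolding blocks_consistent_def
      by (intro bigo_of_le_sum[OF ip_norm_Hmat_nonneg[OF assms(1)] truncation_error_Dx[OF assms(1)]])
        (auto intro: Dx_carrier assms(1))
  qed
  show "consistent_y g p"
    unfolding consistent_y_def
  proof (intro allI impI)
    fix u assume "smooth_near (Omega 1 \<union> Omega 2) u"
    then show "(\<lambda>t. ip_norm (Hmat (g t)) (Dy (g t) *\<^sub>v restr (g t) u - restr (g t) (ddy u)))
          \<in> O[refine g](\<lambda>t. hmax (g t) powr p)"
      using assms(3) unfolding blocks_consistent_def
      by (intro bigo_of_le_sum[OF ip_norm_Hmat_nonneg[OF assms(1)] truncation_error_Dy[OF assms(1)]])
        (auto intro: Dy_carrier assms(1))
  qed
qed

end
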